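(* Let $z\in\mathbb{R}^N$ and let $\lambda_z>0$ be such that for every $\lambda\in(0,\lambda_z)$ there is an open ball $C_{z,\lambda}\ni z$ for which $u_\lambda$ and the maximal subsolution of $\lambda u+H(x,Du)=0$ in $C_{z,\lambda}$ coincide at $z$. Then for every $0<\lambda<\lambda_z$ there exists a Radon probability measure $\mu$ on $\mathbb{R}^{2N}$ with $$\langle\mu,L\rangle=\lambda\,u_\lambda(z)\qquad\text{and}\qquad\langle\mu,\Phi\rangle\ge\lambda\,u(z)$$ for every $\Phi\in C(\mathbb{R}^{2N})$ bounded from below and admitting a $\lambda$-discounted subsolution, and every $\lambda$-discounted subsolution $u$ of $\Phi$.
   Context: $H:\mathbb{R}^N\times\mathbb{R}^N\to\mathbb{R}$ satisfies: (A1) $H$ is continuous; (A2) $p\mapsto H(x,p)$ is convex for every $x$, and for every $R>0$, $\lim_{r\to+\infty}\inf\{H(x,p)\mid |x|<R,\ |p|\ge r\}=+\infty$; (A3) there is $\varepsilon>0$ with $\limsup_{|x|\to+\infty}\sup_{|p|<\varepsilon}H(x,p)<\max_{x\in\mathbb{R}^N}\min_{p\in\mathbb{R}^N}H(x,p)$; and, moreover, $\lim_{|p|\to+\infty}H(x,p)/|p|=+\infty$ for every $x$. Solutions and subsolutions of Hamilton--Jacobi equations are in the viscosity sense. The critical value $c=\inf\{a\in\mathbb{R}\mid H(x,Du)=a \text{ admits subsolutions in }\mathbb{R}^N\}$ is finite and is normalized to be $c=0$. For $\lambda>0$, $u_\lambda$ denotes the maximal subsolution (pointwise supremum of all subsolutions,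 itself a solution) of $\lambda u+H(x,Du)=0$ in $\mathbb{R}^N$; similarly the maximal subsolution in a ball is the pointwise supremum of all subsolutions in that ball. A number $\lambda_z$ as in the claim exists for every $z$ (it is provided by another result of the paper). The Lagrangian is $L(x,q)=\max_{p\in\mathbb{R}^N}\,(p\cdot q-H(x,p))$. For $\Phi\in C(\mathbb{R}^{2N})$, a locally Lipschitz function $u:\mathbb{R}^N\to\mathbb{R}$ is a $\lambda$-discounted subsolution for $\Phi$ if $\lambda u(x)+Du(x)\cdot q\le\Phi(x,q)$ for a.e. $x\in\mathbb{R}^N$ and every $q\in\mathbb{R}^N$. $\langle\mu,\Phi\rangle=\int\Phi\,d\mu$ (possibly $+\infty$ for $\Phi$ bounded from below). *)

theory Defs
  imports "HOL-Analysis.Analysis" "HOL-Probability.Probability_Measure"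
begin

text \<open>
  Viscosity subsolutions of F(x, u, Du) = 0 in an open set \<open>\<Omega>\<close>, in the class of continuous functions.
  The test functions are the C1 functions \<open>\<phi>\<close> on \<open>\<Omega>\<close> such that \<open>u - \<phi>\<close> has a local maximum
  at x, and \<open>g\<close> is the gradient of \<open>\<phi>\<close>.  Functions on \<open>\<Omega>\<close> are represented by total functions
  whose values outside \<open>\<Omega>\<close> are irrelevant.
\<close>

definition viscosity_subsolution ::
  "(real^'n) set \<Rightarrow> (real^'n \<Rightarrow> real \<Rightarrow> real^'n \<Rightarrow> real) \<Rightarrow> (real^'n \<Rightarrow> real) \<Rightarrow> bool" where
  "viscosity_subsolution \<Omega> F u \<longleftrightarrow>
     continuous_on \<Omega> u \<and>
     (\<forall>\<phi> g. (\<forall>y\<in>\<Omega>. GDERIV \<phi> y :> g y) \<and> continuous_on \<Omega> g \<longrightarrow>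
        (\<forall>x\<in>\<Omega>. (\<forall>\<^sub>F y in nhds x. u y - \<phi> y \<le> u x - \<phi> x) \<longrightarrow> F x (u x) (g x) \<le> 0))"

definition critical_value :: "(real^'n \<Rightarrow> real^'n \<Rightarrow> real) \<Rightarrow> ereal" where
  "critical_value H =
     Inf (ereal ` {a. \<exists>u. viscosity_subsolution UNIV (\<lambda>x r p. H x p - a) u})"

text \<open>
  The supremum is a supremum of reals: under the standing assumptions on H, and for \<open>\<Omega>\<close> the
  whole space or a ball, there are subsolutions and their values at each point of \<open>\<Omega>\<close> are
  bounded from above.
\<close>

definition maximal_subsolution ::
  "(real^'n) set \<Rightarrow> real \<Rightarrow> (real^'n \<Rightarrow> real^'n \<Rightarrow> real) \<Rightarrow> real^'n \<Rightarrow> real" where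
  "maximal_subsolution \<Omega> l H x =
     (SUP u\<in>{u. viscosity_subsolution \<Omega> (\<lambda>x r p. l * r + H x p) u}. u x)"

text \<open>For H superlinear and continuous in p, this supremum is finite and attained.\<close>

definition lagrangian ::
  "(real^'n \<Rightarrow> real^'n \<Rightarrow> real) \<Rightarrow> (real^'n) \<times> (real^'n) \<Rightarrow> real" where
  "lagrangian H = (\<lambda>(x, q). SUP p. p \<bullet> q - H x p)"

definition discounted_subsolution ::
  "real \<Rightarrow> ((real^'n) \<times> (real^'n) \<Rightarrow> real) \<Rightarrow> (real^'n \<Rightarrow> real) \<Rightarrow> bool" where
  "discounted_subsolution l \<Phi> u \<longleftrightarrow>
     (\<forall>x. \<exists>r>0. \<exists>K. K-lipschitz_on (ball x r) u) \<and>
     (AE x in lborel. \<exists>d. GDERIV u x :> d \<and> (\<forall>q. l * u x + d \<bullet> q \<le> \<Phi> (x, q)))"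

definition radon_measure :: "('a::topological_space) measure \<Rightarrow> bool" where
  "radon_measure \<mu> \<longleftrightarrow>
     sets \<mu> = sets borel \<and>
     (\<forall>K. compact K \<longrightarrow> emeasure \<mu> K < \<infinity>) \<and>
     (\<forall>B\<in>sets borel. emeasure \<mu> B = (SUP K\<in>{K. K \<subseteq> B \<and> compact K}. emeasure \<mu> K))"

text \<open>
  Integral with values in the extended reals: integral of the positive part minus integral of the
  negative part (\<open>ennreal\<close> sends negative reals to 0).  For \<open>\<Phi>\<close> bounded from below and \<open>\<mu>\<close>
  finite the subtrahend is finite.
\<close>

definition pairing :: "'a measure \<Rightarrow> ('a \<Rightarrow> real) \<Rightarrow> ereal" where
  "pairing \<mu> \<Phi> =
     enn2ereal (\<integral>\<^sup>+ w. ennreal (\<Phi> w) \<partial>\<mu>) - enn2ereal (\<integral>\<^sup>+ w. ennreal (- \<Phi> w) \<partial>\<mu>)"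

end

theory Submission
  imports Defs "HOL-Probability.Probability"
begin

text \<open>
  Let \<open>w\<close> be the common value at \<open>z\<close> of the maximal subsolutions in the whole space and in the ball
  \<open>B\<close>.  Call a probability measure \<open>\<mu>\<close> on position-velocity space closed if
  \<open>\<integral> (l * v(x) + Dv(x) \<bullet> q) d\<mu> = l * v(z)\<close> for every C1 function \<open>v\<close>.  The theorem splits into two
  halves.

  A compactly supported closed measure tests every subsolution.  If \<open>u\<close> is a \<open>l\<close>-discounted subsolution
  for \<open>\<Phi>\<close>, its convolution with a small bump is C1 and satisfies the same inequality up to a small
  error on the support of \<open>\<mu>\<close>; integrating gives \<open>l * u(z) \<le> \<integral> \<Phi> d\<mu>\<close>.  The same applies to viscosity
  subsolutions of \<open>l * u + H(x, Du) = 0\<close> and \<open>\<Phi> = L\<close>: they solve, for each fixed velocity \<open>q\<close>, the linear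
  inequality \<open>l * u + Du \<bullet> q \<le> L(x, q)\<close>, and a maximum principle integrates it along segments of
  direction \<open>q\<close>, without recourse to the points of differentiability of \<open>u\<close>.  Both cases are reduced to one notion,
  \<open>weak_subsolution\<close>, and lead to \<open>weak_subsolution_le_integral\<close>.  In particular \<open>\<integral> L d\<mu> \<ge> l * w\<close>.

  There is a closed measure with \<open>\<integral> L d\<mu> \<le> l * w\<close>, supported by the closure of \<open>B\<close> times a ball of
  velocities of radius \<open>R\<close>.  By duality (\<open>measure_duality\<close>) the only obstruction would be a C1 function
  \<open>v\<close> with \<open>l * v + Dv \<bullet> q \<le> L(x, q)\<close> on that compact set and \<open>v(z) > w\<close>.  Replacing \<open>v\<close> by its maximum
  with a very negative constant, one obtains a viscosity subsolution in \<open>B\<close>: where the constant is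
  not active, \<open>v\<close> is bounded below, and this bound is what makes the velocities of norm at most \<open>R\<close>
  sufficient to recover \<open>H\<close> from \<open>L\<close> (\<open>bounded_velocities_suffice\<close>).  Its value at \<open>z\<close> exceeds the
  maximal subsolution in \<open>B\<close>, a contradiction (\<open>optimal_closed_measure\<close>).

  The duality theorem is a Hahn-Banach argument followed by a passage to weak limits of probability
  measures.  The compactness of the set of measures is imported from the real line, where it is
  Helly's theorem, through a continuous curve that fills a box.
\<close>

section \<open>A space-filling curve\<close>

text \<open>
  Schoenberg's construction: a continuous function of period 2 that is 0 on \<open>[0, 1/3]\<close> and 1 on
  \<open>[2/3, 1]\<close>, so that it reads off the leading digit of a point of the Cantor set.
\<close>

definition schoenberg_wave :: "real \<Rightarrow> real" where
  "schoenberg_wave t = max 0 (min 1 (1/2 - cos (pi * t)))"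

lemma schoenberg_wave_bounds: "0 \<le> schoenberg_wave t" "schoenberg_wave t \<le> 1"
  by (auto simp: schoenberg_wave_def)

lemma schoenberg_wave_add_even:
  assumes "m \<in> \<int>"
  shows "schoenberg_wave (2 * m + t) = schoenberg_wave t"
proof -
  have "cos (pi * (2 * m + t)) = cos (pi * t)"
    using cos.plus_of_int[of "pi * t"] assms by (auto elim!: Ints_cases simp: algebra_simps)
  then show ?thesis by (simp add: schoenberg_wave_def)
qed

text \<open>
  The point of the Cantor set whose ternary digits are 0 and 2 according to the given sequence.
\<close>

definition ternary :: "(nat \<Rightarrow> bool) \<Rightarrow> real" where
  "ternary a = (\<Sum>i. 2 * of_bool (a i) * (1/3) ^ Suc i)"

lemma ternary_summable: "summable (\<lambda>i. 2 * of_bool (a i) * (1/3::real) ^ Suc i)"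
  by (rule summable_comparison_test'[of "\<lambda>i. 2 * (1/3::real) ^ Suc i" 0])
     (auto intro!: summable_mult summable_geometric)

lemma ternary_bounds: "0 \<le> ternary a" "ternary a \<le> 1"
proof -
  show "0 \<le> ternary a" unfolding ternary_def
    by (rule suminf_nonneg[OF ternary_summable]) auto
  have s: "(\<lambda>i. 2 * (1/3::real) ^ Suc i) sums 1"
    using sums_mult[OF geometric_sums[of "1/3::real"], of "2/3"] by simp
  have "ternary a \<le> (\<Sum>i. 2 * (1/3::real) ^ Suc i)" unfolding ternary_def
    by (rule suminf_le[OF _ ternary_summable sums_summable[OF s]]) auto
  then show "ternary a \<le> 1" using sums_unique[OF s] by simp
qed

lemma ternary_step: "3 * ternary a = 2 * of_bool (a 0) + ternary (\<lambda>i. a (Suc i))"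
proof -
  have "ternary a = 2/3 * of_bool (a 0) + (\<Sum>i. 2 * of_bool (a (Suc i)) * (1/3::real) ^ Suc (Suc i))"
    unfolding ternary_def using suminf_split_head[OF ternary_summable, of a] by simp
  also have "(\<Sum>i. 2 * of_bool (a (Suc i)) * (1/3::real) ^ Suc (Suc i)) = ternary (\<lambda>i. a (Suc i)) / 3"
    unfolding ternary_def using suminf_divide[OF ternary_summable[of "\<lambda>i. a (Suc i)"], of 3]
    by (simp add: field_simps)
  finally show ?thesis by simp
qed

text \<open>
  Multiplying by \<open>3 ^ n\<close> moves the digits before the \<open>n\<close>-th one into an even integer, which periodicity
  removes; the \<open>n\<close>-th digit then decides between \<open>[0, 1/3]\<close> and \<open>[2/3, 1]\<close>.
\<close>

lemma schoenberg_wave_ternary: "schoenberg_wave (3 ^ n * ternary a) = of_bool (a n)"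
proof -
  have shift: "\<exists>m\<in>\<int>. 3 ^ n * ternary a = 2 * m + ternary (\<lambda>i. a (n + i))"
  proof (induction n)
    case 0
    show ?case by (intro bexI[of _ 0]) auto
  next
    case (Suc n)
    then obtain m where m: "m \<in> \<int>" "3 ^ n * ternary a = 2 * m + ternary (\<lambda>i. a (n + i))" by auto
    have "3 ^ Suc n * ternary a = 3 * (3 ^ n * ternary a)" by simp
    also have "\<dots> = 3 * (2 * m) + 3 * ternary (\<lambda>i. a (n + i))" by (simp only: m distrib_left)
    also have "\<dots> = 2 * (3 * m + of_bool (a n)) + ternary (\<lambda>i. a (Suc n + i))"
      using ternary_step[of "\<lambda>i. a (n + i)"] by simp
    finally show ?case using m by (intro bexI[of _ "3 * m + of_bool (a n)"]) auto
  qed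
  define r where "r = ternary (\<lambda>i. a (Suc n + i))"
  have r: "0 \<le> r" "r \<le> 1" using ternary_bounds by (auto simp: r_def)
  have "ternary (\<lambda>i. a (n + i)) = (2 * of_bool (a n) + r) / 3"
    using ternary_step[of "\<lambda>i. a (n + i)"] by (simp add: r_def)
  with shift schoenberg_wave_add_even
  have *: "schoenberg_wave (3 ^ n * ternary a) = schoenberg_wave ((2 * of_bool (a n) + r) / 3)"
    by metis
  show ?thesis
  proof (cases "a n")
    case True
    have "cos (pi * ((2 + r) / 3)) \<le> cos (2 * pi / 3)"
      using r by (intro cos_monotone_0_pi_le) (auto simp: field_simps)
    then have "cos (pi * ((2 + r) / 3)) \<le> - 1/2"
      by (simp add: cos_120)
    then show ?thesis using True * by (simp add: schoenberg_wave_def)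
  next
    case False
    have "cos (pi / 3) \<le> cos (pi * (r / 3))"
      using r by (intro cos_monotone_0_pi_le) (auto simp: field_simps)
    then have "1/2 \<le> cos (pi * (r / 3))" by (simp add: cos_60)
    then show ?thesis using False * by (simp add: schoenberg_wave_def)
  qed
qed

lemma binary_expansion:
  fixes y :: real
  assumes "0 \<le> y" "y \<le> 1"
  obtains c :: "nat \<Rightarrow> bool" where "(\<lambda>k. of_bool (c k) * (1/2) ^ Suc k) sums y"
proof -
  define s where "s = rec_nat y (\<lambda>_ t. 2 * t - of_bool (t \<ge> 1/2))"
  have s0: "s 0 = y" and sS: "s (Suc n) = 2 * s n - of_bool (s n \<ge> 1/2)" for n
    by (auto simp: s_def)
  have b: "0 \<le> s n \<and> s n \<le> 1" for n
    by (induction n) (use assms in \<open>auto simp: s0 sS\<close>)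
  have part: "(\<Sum>k<n. of_bool (s k \<ge> 1/2) * (1/2) ^ Suc k) = y - s n * (1/2) ^ n" for n
    by (induction n) (auto simp: s0 sS field_simps)
  have "(\<lambda>n. s n * (1/2) ^ n) \<longlonglongrightarrow> 0"
  proof (rule tendsto_sandwich[of "\<lambda>_. 0" _ _ "\<lambda>n. (1/2) ^ n"])
    show "\<forall>\<^sub>F n in sequentially. s n * (1/2) ^ n \<le> (1/2) ^ n"
      using b by (auto intro!: always_eventually mult_left_le_one_le)
  qed (use b in \<open>auto intro!: always_eventually LIMSEQ_realpow_zero\<close>)
  then have "(\<lambda>n. y - s n * (1/2) ^ n) \<longlonglongrightarrow> y - 0" by (intro tendsto_intros)
  then have "(\<lambda>k. of_bool (s k \<ge> 1/2) * (1/2) ^ Suc k) sums y"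
    unfolding sums_def part by simp
  then show thesis by (rule that)
qed

text \<open>
  Each coordinate is the number whose binary digits are read off by the wave at its own infinite set
  of scales \<open>3 ^ e\<close>.  These sets are disjoint for different coordinates, so all the coordinates of a
  point of the box can be prescribed by a single point of the Cantor set.
\<close>

theorem space_filling_curve:
  fixes a b :: "'a::euclidean_space"
  obtains \<gamma> :: "real \<Rightarrow> 'a" where "continuous_on UNIV \<gamma>" "cbox a b \<subseteq> \<gamma> ` {0..1}"
proof -
  obtain idx :: "'a \<Rightarrow> nat" where idx: "inj_on idx Basis"
    using finite_imp_inj_to_nat_seg[OF finite_Basis] by blast
  define e where "e i k = prod_encode (idx i, k)" for i k
  define x where "x i t = (\<Sum>k. schoenberg_wave (3 ^ e i k * t) * (1/2) ^ Suc k)" for i t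
  define \<gamma> where "\<gamma> t = (\<Sum>i\<in>Basis. (a \<bullet> i + x i t * (b \<bullet> i - a \<bullet> i)) *\<^sub>R i)" for t
  have cont_x: "continuous_on UNIV (x i)" for i
  proof (rule uniform_limit_theorem)
    show "uniform_limit UNIV (\<lambda>n t. \<Sum>k<n. schoenberg_wave (3 ^ e i k * t) * (1/2) ^ Suc k) (x i) sequentially"
      unfolding x_def
      by (rule Weierstrass_m_test[where M = "\<lambda>k. (1/2) ^ Suc k"])
         (use schoenberg_wave_bounds in \<open>auto simp: abs_mult intro!: summable_geometric summable_mult mult_left_le_one_le\<close>)
    show "\<forall>\<^sub>F n in sequentially. continuous_on UNIV (\<lambda>t. \<Sum>k<n. schoenberg_wave (3 ^ e i k * t) * (1/2) ^ Suc k)"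
      by (auto simp: schoenberg_wave_def intro!: always_eventually continuous_intros)
  qed auto
  show thesis
  proof
    show "continuous_on UNIV \<gamma>"
      unfolding \<gamma>_def by (intro continuous_intros cont_x)
    show "cbox a b \<subseteq> \<gamma> ` {0..1}"
    proof
      fix p assume p: "p \<in> cbox a b"
      have "\<exists>c. (\<lambda>k. of_bool (c k) * (1/2) ^ Suc k) sums ((p \<bullet> i - a \<bullet> i) / (b \<bullet> i - a \<bullet> i))"
        if "i \<in> Basis" for i
      proof -
        have "a \<bullet> i \<le> p \<bullet> i" "p \<bullet> i \<le> b \<bullet> i" using p that by (auto simp: mem_box)
        then have "0 \<le> (p \<bullet> i - a \<bullet> i) / (b \<bullet> i - a \<bullet> i)" "(p \<bullet> i - a \<bullet> i) / (b \<bullet> i - a \<bullet> i) \<le> 1"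
          by (auto simp: divide_le_eq_1)
        then show ?thesis by (rule binary_expansion) blast
      qed
      then obtain c where
        c: "\<And>i. i \<in> Basis \<Longrightarrow> (\<lambda>k. of_bool (c i k) * (1/2) ^ Suc k) sums ((p \<bullet> i - a \<bullet> i) / (b \<bullet> i - a \<bullet> i))"
        by metis
      define d where "d n = (case prod_decode n of (j, k) \<Rightarrow> c (inv_into Basis idx j) k)" for n
      have d: "d (e i k) = c i k" if "i \<in> Basis" for i k
        using that idx by (simp add: d_def e_def)
      have "x i (ternary d) = (p \<bullet> i - a \<bullet> i) / (b \<bullet> i - a \<bullet> i)" if "i \<in> Basis" for i
        unfolding x_def schoenberg_wave_ternary d[OF that]
        using c[OF that] by (simp only: sums_unique[symmetric])
      moreover have "p \<bullet> i = a \<bullet> i" if "i \<in> Basis" "b \<bullet> i = a \<bullet> i" for i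
        using p that by (auto simp: mem_box intro: antisym)
      ultimately have "\<gamma> (ternary d) = (\<Sum>i\<in>Basis. (p \<bullet> i) *\<^sub>R i)"
        unfolding \<gamma>_def by (intro sum.cong) auto
      then have "\<gamma> (ternary d) = p" by (simp add: euclidean_representation)
      then show "p \<in> \<gamma> ` {0..1}" using ternary_bounds by auto
    qed
  qed
qed

section \<open>Probability measures annihilating a space of functions\<close>

definition distributions_on :: "real set \<Rightarrow> real measure set" where
  "distributions_on T = {\<nu>. real_distribution \<nu> \<and> (AE t in \<nu>. t \<in> T)}"

definition bounded_continuous :: "(real \<Rightarrow> real) \<Rightarrow> bool" where
  "bounded_continuous f \<longleftrightarrow> continuous_on UNIV f \<and> bounded (range f)"

lemma bounded_continuousE:
  assumes "bounded_continuous f"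
  obtains B where "continuous_on UNIV f" "\<And>t. \<bar>f t\<bar> \<le> B" "B > 0"
proof -
  from assms obtain B where "B > 0" "\<forall>t\<in>range f. norm t \<le> B"
    unfolding bounded_continuous_def bounded_pos by blast
  with assms show thesis by (intro that[of B]) (auto simp: bounded_continuous_def)
qed

lemma bounded_continuous_diff:
  "bounded_continuous f \<Longrightarrow> bounded_continuous g \<Longrightarrow> bounded_continuous (\<lambda>t. f t - c * g t)"
  unfolding bounded_continuous_def
  using bounded_scaleR_comp[of g UNIV c]
  by (auto intro!: continuous_intros bounded_minus_comp)

lemma distributions_on_integrable:
  assumes "\<nu> \<in> distributions_on T" "bounded_continuous f"
  shows "integrable \<nu> f"
proof -
  interpret real_distribution \<nu> using assms by (simp add: distributions_on_def)
  from assms(2) obtain B where "continuous_on UNIV f" "\<And>t. \<bar>f t\<bar> \<le> B" by (elim bounded_continuousE) blast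
  then have "f \<in> borel_measurable borel" "\<And>t. \<bar>f t\<bar> \<le> B" by (auto intro: borel_measurable_continuous_onI)
  then show ?thesis by (intro integrable_const_bound[of _ B]) auto
qed

lemma distributions_on_integral_bound:
  assumes \<nu>: "\<nu> \<in> distributions_on T" and f: "bounded_continuous f" and B: "\<And>t. t \<in> T \<Longrightarrow> f t \<le> B"
  shows "(\<integral>t. f t \<partial>\<nu>) \<le> B"
proof -
  interpret real_distribution \<nu> using assms by (simp add: distributions_on_def)
  have "(\<integral>t. f t \<partial>\<nu>) \<le> (\<integral>t. B \<partial>\<nu>)"
    using \<nu> B distributions_on_integrable[OF \<nu> f]
    by (intro integral_mono_AE) (auto simp: distributions_on_def elim!: AE_mp)
  then show ?thesis using prob_space by simp
qed

text \<open>
  Convexity of the set of distributions: the mixture is the law obtained by tossing a biased coin first.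
\<close>

lemma mixture_in_distributions_on:
  assumes "\<nu>1 \<in> distributions_on T" "\<nu>2 \<in> distributions_on T" "0 \<le> s" "s \<le> 1"
  obtains \<nu> where "\<nu> \<in> distributions_on T"
    "\<And>f. bounded_continuous f \<Longrightarrow> (\<integral>t. f t \<partial>\<nu>) = s * (\<integral>t. f t \<partial>\<nu>1) + (1 - s) * (\<integral>t. f t \<partial>\<nu>2)"
proof
  define N where "N b = (if b then \<nu>1 else \<nu>2)" for b
  define \<nu> where "\<nu> = measure_pmf (bernoulli_pmf s) \<bind> N"
  interpret n1: real_distribution \<nu>1 using assms by (simp add: distributions_on_def)
  interpret n2: real_distribution \<nu>2 using assms by (simp add: distributions_on_def)
  have N: "N b \<in> space (prob_algebra borel)" for b
    using n1.prob_space_axioms n2.prob_space_axioms by (simp add: N_def space_prob_algebra)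
  have N': "N \<in> measurable (measure_pmf (bernoulli_pmf s)) (prob_algebra borel)"
    using N by (simp add: measurable_def)
  then have N'': "N \<in> measurable (measure_pmf (bernoulli_pmf s)) (subprob_algebra borel)"
    by (rule measurable_prob_algebraD)
  have p: "prob_space \<nu>" unfolding \<nu>_def
    by (rule prob_space_bind'[OF _ N']) (auto simp: space_prob_algebra measure_pmf.prob_space_axioms)
  have sts: "sets \<nu> = sets borel" unfolding \<nu>_def
    by (rule sets_bind) (use n1.events_eq_borel n2.events_eq_borel in \<open>auto simp: N_def\<close>)
  have ae: "AE t in \<nu>. t \<in> T"
  proof -
    have 1: "AE t in \<nu>1. t \<in> T" "AE t in \<nu>2. t \<in> T" using assms by (auto simp: distributions_on_def)
    from AE_E3[OF 1(1)] obtain A1 where A1: "\<And>t. t \<in> space \<nu>1 - A1 \<Longrightarrow> t \<in> T" "A1 \<in> null_sets \<nu>1" by blast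
    from AE_E3[OF 1(2)] obtain A2 where A2: "\<And>t. t \<in> space \<nu>2 - A2 \<Longrightarrow> t \<in> T" "A2 \<in> null_sets \<nu>2" by blast
    have m: "A1 \<inter> A2 \<in> sets borel" using A1 A2 by (auto simp: null_sets_def)
    have "emeasure \<nu> (A1 \<inter> A2) = (\<integral>\<^sup>+ b. emeasure (N b) (A1 \<inter> A2) \<partial>measure_pmf (bernoulli_pmf s))"
      unfolding \<nu>_def by (rule emeasure_bind[OF _ N'' m]) auto
    also have "\<dots> = (\<integral>\<^sup>+ b. 0 \<partial>measure_pmf (bernoulli_pmf s))"
    proof (rule nn_integral_cong)
      fix b
      have "A1 \<inter> A2 \<in> null_sets \<nu>1" "A1 \<inter> A2 \<in> null_sets \<nu>2"
        using A1 A2 m by (auto intro: null_sets_subset)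
      then show "emeasure (N b) (A1 \<inter> A2) = 0" by (simp add: N_def null_sets_def)
    qed
    finally have "A1 \<inter> A2 \<in> null_sets \<nu>" using m sts by (simp add: null_sets_def)
    then show ?thesis using A1(1) A2(1)
      by (auto intro!: AE_I')
  qed
  show "\<nu> \<in> distributions_on T"
    unfolding distributions_on_def real_distribution_def real_distribution_axioms_def
    using p sts ae by (auto)
  fix f assume f: "bounded_continuous f"
  then obtain B where B: "continuous_on UNIV f" "\<And>t. \<bar>f t\<bar> \<le> B" "B > 0" by (elim bounded_continuousE) blast
  have "(\<integral>t. f t \<partial>\<nu>) = (\<integral>b. (\<integral>t. f t \<partial>N b) \<partial>measure_pmf (bernoulli_pmf s))"
    unfolding \<nu>_def
  proof (rule integral_bind[OF _ _ N'', where B = B and B' = 1])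
    show "f \<in> borel_measurable borel" using B by (intro borel_measurable_continuous_onI)
    show "AE x in measure_pmf (bernoulli_pmf s). emeasure (N x) (space (N x)) \<le> ennreal 1"
      using n1.emeasure_space_1 n2.emeasure_space_1 by (simp add: N_def)
  qed (use B in \<open>auto intro: measure_pmf.finite_measure_axioms\<close>)
  also have "\<dots> = s * (\<integral>t. f t \<partial>\<nu>1) + (1 - s) * (\<integral>t. f t \<partial>\<nu>2)"
    using assms by (simp add: N_def)
  finally show "(\<integral>t. f t \<partial>\<nu>) = s * (\<integral>t. f t \<partial>\<nu>1) + (1 - s) * (\<integral>t. f t \<partial>\<nu>2)" .
qed

text \<open>
  Distributions on a compact set are tight, so Helly's selection theorem applies; the limit still
  lives on \<open>T\<close> because the distance to \<open>T\<close> has integral 0 along the sequence.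
\<close>

lemma distributions_on_seq_compact:
  assumes T: "compact T" and \<nu>: "\<And>n. \<nu> n \<in> distributions_on T"
  obtains r \<nu>' where "strict_mono (r :: nat \<Rightarrow> nat)" "\<nu>' \<in> distributions_on T"
    "\<And>f. bounded_continuous f \<Longrightarrow> (\<lambda>n. \<integral>t. f t \<partial>\<nu> (r n)) \<longlonglongrightarrow> (\<integral>t. f t \<partial>\<nu>')"
proof -
  have rd: "real_distribution (\<nu> n)" for n using \<nu> by (auto simp: distributions_on_def)
  obtain B where B: "\<And>t. t \<in> T \<Longrightarrow> \<bar>t\<bar> \<le> B" "B > 0"
    using compact_imp_bounded[OF T] by (auto simp: bounded_pos)
  have "tight \<nu>" unfolding tight_def
  proof (intro conjI allI impI)
    fix e :: real assume "e > 0"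
    have "measure (\<nu> n) {-B - 1<..B} > 1 - e" for n
    proof -
      interpret real_distribution "\<nu> n" by fact
      have "AE t in \<nu> n. t \<in> T" using \<nu>[of n] by (simp add: distributions_on_def)
      then have "AE t in \<nu> n. t \<in> {-B - 1<..B}"
      proof eventually_elim
        case (elim t)
        then show ?case using B(1)[of t] by auto
      qed
      then have "prob {-B - 1<..B} = 1" by (subst prob_eq_1) auto
      then show ?thesis using \<open>e > 0\<close> by simp
    qed
    then show "\<exists>a b. a < b \<and> (\<forall>n. measure (\<nu> n) {a<..b} > 1 - e)"
      using B by (intro exI[of _ "-B - 1"] exI[of _ B]) auto
  qed (rule rd)
  from tight_imp_convergent_subsubsequence[OF this, of id] obtain r M where
    r: "strict_mono (r :: nat \<Rightarrow> nat)" and M: "real_distribution M" and w: "weak_conv_m (\<nu> \<circ> r) M"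
    by (auto simp: strict_mono_id o_def)
  have conv: "(\<lambda>n. \<integral>t. f t \<partial>\<nu> (r n)) \<longlonglongrightarrow> (\<integral>t. f t \<partial>M)" if "bounded_continuous f" for f
  proof -
    from that obtain C where C: "continuous_on UNIV f" "\<And>t. \<bar>f t\<bar> \<le> C" by (elim bounded_continuousE) blast
    have "(\<lambda>n. \<integral>t. f t \<partial>(\<nu> \<circ> r) n) \<longlonglongrightarrow> (\<integral>t. f t \<partial>M)"
      by (rule weak_conv_imp_integral_bdd_continuous_conv[of _ _ f C])
         (use C w M rd in \<open>auto simp: continuous_on_eq_continuous_at o_def\<close>)
    then show ?thesis by simp
  qed
  interpret M: real_distribution M by fact
  define f where "f t = min 1 (infdist t T)" for t
  have f: "bounded_continuous f" unfolding bounded_continuous_def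
  proof
    show "bounded (range f)"
      by (rule boundedI[of _ 1]) (auto simp: f_def infdist_nonneg abs_of_nonneg)
  qed (auto simp: f_def[abs_def] intro!: continuous_intros)
  have f0: "(\<integral>t. f t \<partial>\<nu> n) = 0" for n
  proof -
    have "(\<integral>t. f t \<partial>\<nu> n) = (\<integral>t. 0 \<partial>\<nu> n)"
    proof (rule integral_cong_AE)
      interpret real_distribution "\<nu> n" by fact
      show "f \<in> borel_measurable (\<nu> n)" 
        using f borel_measurable_continuous_onI[of f] by (simp add: bounded_continuous_def)
      show "AE t in \<nu> n. f t = 0"
        using \<nu>[of n] by (auto simp: distributions_on_def f_def elim!: AE_mp)
    qed simp
    then show ?thesis by simp
  qed
  have neT: "T \<noteq> {}"
  proof
    assume "T = {}"
    then have "AE t in \<nu> 0. False" using \<nu>[of 0] by (simp add: distributions_on_def)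
    then show False using rd[of 0] prob_space.AE_False real_distribution_def by blast
  qed
  have "(\<integral>t. f t \<partial>M) = 0" using LIMSEQ_unique[OF conv[OF f, unfolded f0] tendsto_const] by simp
  moreover have "integrable M f"
    using f by (intro distributions_on_integrable[of M UNIV]) (auto simp: distributions_on_def M)
  ultimately have "AE t in M. f t = 0"
    by (subst (asm) integral_nonneg_eq_0_iff_AE) (auto simp: f_def infdist_nonneg)
  then have "AE t in M. t \<in> T"
    using neT T by (auto simp: f_def min_def in_closed_iff_infdist_zero compact_imp_closed
        elim!: AE_mp split: if_splits)
  with M have "M \<in> distributions_on T" by (simp add: distributions_on_def)
  with r conv show thesis using that by blast
qed

text \<open>
  Theorem of the alternative for finitely many constraints.  The induction adds one constraint \<open>\<phi> n\<close>
  at a time: among the measures that satisfy the previous constraints, the pairs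
  \<open>(\<integral> \<phi> n, \<integral> h)\<close> form a compact convex subset of the plane, and a line separating it from the half-line
  \<open>{0} \<times> (-\<infinity>, 0]\<close> would contradict the induction hypothesis for \<open>h\<close> tilted by a multiple of \<open>\<phi> n\<close>.
\<close>

lemma finite_duality:
  fixes n :: nat
  assumes T: "compact T"
    and \<phi>: "\<And>i. i < n \<Longrightarrow> bounded_continuous (\<phi> i)" and h: "bounded_continuous h"
    and alt: "\<And>c. \<exists>t\<in>T. h t \<le> (\<Sum>i<n. c i * \<phi> i t)"
  shows "\<exists>\<nu>\<in>distributions_on T. (\<forall>i<n. (\<integral>t. \<phi> i t \<partial>\<nu>) = 0) \<and> (\<integral>t. h t \<partial>\<nu>) \<le> 0"
  using \<phi> h alt
proof (induction n arbitrary: h)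
  case 0
  then obtain t where t: "t \<in> T" "h t \<le> 0" by auto
  have "h \<in> borel_measurable borel"
    using 0 by (auto simp: bounded_continuous_def intro!: borel_measurable_continuous_onI)
  then have "(\<integral>t. h t \<partial>return borel t) = h t" by (simp add: integral_return)
  moreover have "AE x in return borel t. x \<in> T"
    using t borel_compact[OF T] by (subst AE_return) (auto simp: pred_def)
  then have "return borel t \<in> distributions_on T" using t
    by (auto simp: distributions_on_def real_distribution_def real_distribution_axioms_def prob_space_return)
  ultimately show ?case using t by (intro bexI[of _ "return borel t"]) auto
next
  case (Suc n)
  note h = Suc.prems(2)
  have \<phi>n: "bounded_continuous (\<phi> n)" using Suc.prems(1) by auto
  define M where "M = {\<nu>\<in>distributions_on T. \<forall>i<n. (\<integral>t. \<phi> i t \<partial>\<nu>) = 0}"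
  define S where "S = (\<lambda>\<nu>. (\<integral>t. \<phi> n t \<partial>\<nu>, \<integral>t. h t \<partial>\<nu>)) ` M"
  have tilted: "\<exists>\<nu>\<in>M. (\<integral>t. h t \<partial>\<nu>) \<le> a * (\<integral>t. \<phi> n t \<partial>\<nu>)" for a
  proof -
    have "\<exists>\<nu>\<in>distributions_on T. (\<forall>i<n. (\<integral>t. \<phi> i t \<partial>\<nu>) = 0) \<and> (\<integral>t. h t - a * \<phi> n t \<partial>\<nu>) \<le> 0"
    proof (rule Suc.IH)
      fix c :: "nat \<Rightarrow> real"
      obtain t where t: "t \<in> T" "h t \<le> (\<Sum>i<Suc n. (c(n := a)) i * \<phi> i t)"
        using Suc.prems(3) by blast
      have "(\<Sum>i<n. (c(n := a)) i * \<phi> i t) = (\<Sum>i<n. c i * \<phi> i t)" by (intro sum.cong) auto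
      with t show "\<exists>t\<in>T. h t - a * \<phi> n t \<le> (\<Sum>i<n. c i * \<phi> i t)" by (intro bexI[of _ t]) auto
    qed (use Suc.prems \<phi>n in \<open>auto intro: bounded_continuous_diff\<close>)
    then obtain \<nu> where \<nu>: "\<nu> \<in> M" "(\<integral>t. h t - a * \<phi> n t \<partial>\<nu>) \<le> 0" by (auto simp: M_def)
    then have "integrable \<nu> h" "integrable \<nu> (\<phi> n)"
      using h \<phi>n by (auto simp: M_def intro: distributions_on_integrable)
    with \<nu> show ?thesis by (intro bexI[of _ \<nu>]) auto
  qed
  have "compact S" unfolding compact_eq_seq_compact_metric seq_compact_def
  proof (intro allI impI)
    fix p :: "nat \<Rightarrow> real \<times> real" assume "\<forall>k. p k \<in> S"
    then obtain \<nu> where \<nu>: "\<And>k. \<nu> k \<in> M" "\<And>k. p k = (\<integral>t. \<phi> n t \<partial>\<nu> k, \<integral>t. h t \<partial>\<nu> k)"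
      unfolding S_def image_iff by metis
    obtain r \<nu>' where r: "strict_mono (r :: nat \<Rightarrow> nat)" "\<nu>' \<in> distributions_on T"
      "\<And>f. bounded_continuous f \<Longrightarrow> (\<lambda>k. \<integral>t. f t \<partial>\<nu> (r k)) \<longlonglongrightarrow> (\<integral>t. f t \<partial>\<nu>')"
      using distributions_on_seq_compact[OF T, of \<nu>] \<nu>(1) unfolding M_def by blast
    have "(\<integral>t. \<phi> i t \<partial>\<nu>') = 0" if "i < n" for i
    proof -
      have "(\<lambda>k. \<integral>t. \<phi> i t \<partial>\<nu> (r k)) = (\<lambda>k. 0)" using \<nu>(1) that by (auto simp: M_def)
      with r(3)[of "\<phi> i"] Suc.prems(1)[of i] that show ?thesis by (simp add: LIMSEQ_const_iff)
    qed
    then have "\<nu>' \<in> M" using r by (simp add: M_def)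
    moreover have "(p \<circ> r) \<longlonglongrightarrow> (\<integral>t. \<phi> n t \<partial>\<nu>', \<integral>t. h t \<partial>\<nu>')"
      unfolding o_def \<nu>(2) by (intro tendsto_Pair r(3) \<phi>n h)
    ultimately show "\<exists>l\<in>S. \<exists>r. strict_mono r \<and> (p \<circ> r) \<longlonglongrightarrow> l"
      using r(1) unfolding S_def by blast
  qed
  moreover have "convex S" unfolding convex_alt
  proof (intro ballI allI impI)
    fix x y and s :: real assume "x \<in> S" "y \<in> S" and s: "0 \<le> s \<and> s \<le> 1"
    then obtain \<nu>1 \<nu>2 where n: "\<nu>1 \<in> M" "\<nu>2 \<in> M" "x = (\<integral>t. \<phi> n t \<partial>\<nu>1, \<integral>t. h t \<partial>\<nu>1)"
      "y = (\<integral>t. \<phi> n t \<partial>\<nu>2, \<integral>t. h t \<partial>\<nu>2)" by (auto simp: S_def)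
    obtain \<nu> where \<nu>: "\<nu> \<in> distributions_on T"
      "\<And>f. bounded_continuous f \<Longrightarrow> (\<integral>t. f t \<partial>\<nu>) = s * (\<integral>t. f t \<partial>\<nu>2) + (1 - s) * (\<integral>t. f t \<partial>\<nu>1)"
      by (rule mixture_in_distributions_on[of \<nu>2 T \<nu>1 s]) (use s n in \<open>auto simp: M_def\<close>)
    have "\<nu> \<in> M" using \<nu> n Suc.prems(1) by (auto simp: M_def)
    moreover have "(1 - s) *\<^sub>R x + s *\<^sub>R y = (\<integral>t. \<phi> n t \<partial>\<nu>, \<integral>t. h t \<partial>\<nu>)"
      using \<nu>(2)[OF h] \<nu>(2)[OF \<phi>n] n by simp
    ultimately show "(1 - s) *\<^sub>R x + s *\<^sub>R y \<in> S" by (auto simp: S_def)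
  qed
  moreover have "S \<noteq> {}" using tilted[of 0] by (auto simp: S_def)
  moreover have "convex ({0::real} \<times> {..0::real})" "closed ({0::real} \<times> {..0::real})"
    by (auto intro!: convex_Times closed_Times)
  ultimately have sep: "S \<inter> {0} \<times> {..0} = {} \<Longrightarrow>
      \<exists>a b. (\<forall>x\<in>S. inner a x < b) \<and> (\<forall>x\<in>{0::real} \<times> {..0::real}. inner a x > b)"
    by (intro separating_hyperplane_compact_closed) auto
  have "S \<inter> {0} \<times> {..0} \<noteq> {}"
  proof
    assume "S \<inter> {0} \<times> {..0} = {}"
    with sep obtain a1 a2 b where ab: "\<And>x y. (x, y) \<in> S \<Longrightarrow> a1 * x + a2 * y < b" "\<And>y. y \<le> 0 \<Longrightarrow> a2 * y > b"
      by (force simp: inner_Pair)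
    from ab(2)[of 0] have b: "b < 0" by simp
    have "a2 \<le> 0"
    proof (rule ccontr)
      assume "\<not> a2 \<le> 0"
      then show False using ab(2)[of "b / a2"] b by (auto simp: divide_le_0_iff)
    qed
    \<comment> \<open>The slope of the separating line tells which multiple to tilt by; a vertical line calls for a large multiple, which beats the bound on \<open>h\<close>.\<close>
    then consider "a2 < 0" | "a2 = 0" by linarith
    then show False
    proof cases
      case 1
      obtain \<nu> where \<nu>: "\<nu> \<in> M" "(\<integral>t. h t \<partial>\<nu>) \<le> (- a1 / a2) * (\<integral>t. \<phi> n t \<partial>\<nu>)" using tilted by blast
      have "a1 * (\<integral>t. \<phi> n t \<partial>\<nu>) + a2 * (\<integral>t. h t \<partial>\<nu>) < b" using \<nu> by (intro ab) (auto simp: S_def)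
      moreover have "a2 * ((- a1 / a2) * (\<integral>t. \<phi> n t \<partial>\<nu>)) \<le> a2 * (\<integral>t. h t \<partial>\<nu>)"
        using \<nu> 1 by (intro mult_left_mono_neg) auto
      ultimately show False using 1 b by simp
    next
      case 2
      obtain B where B: "\<And>t. \<bar>h t\<bar> \<le> B" "B > 0" using h by (elim bounded_continuousE) blast
      define N where "N = (B + 1) / (- b)"
      have N: "N > 0" "N * b = - (B + 1)" using b B(2) by (auto simp: N_def divide_pos_neg)
      obtain \<nu> where \<nu>: "\<nu> \<in> M" "(\<integral>t. h t \<partial>\<nu>) \<le> (N * a1) * (\<integral>t. \<phi> n t \<partial>\<nu>)" using tilted by blast
      have "a1 * (\<integral>t. \<phi> n t \<partial>\<nu>) < b" using \<nu> 2 ab(1)[of _ "\<integral>t. h t \<partial>\<nu>"] by (auto simp: S_def)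
      then have "N * (a1 * (\<integral>t. \<phi> n t \<partial>\<nu>)) < N * b" using N by (intro mult_strict_left_mono)
      then have "(\<integral>t. h t \<partial>\<nu>) < - B" using \<nu> N by (simp add: mult.assoc)
      moreover have "(\<integral>t. - h t \<partial>\<nu>) \<le> B"
        using \<nu> B bounded_continuous_diff[of "\<lambda>_. 0" h 1] h
        by (intro distributions_on_integral_bound[of \<nu> T])
           (auto simp: M_def bounded_continuous_def abs_le_iff)
      ultimately show False by simp
    qed
  qed
  then obtain \<nu> where "\<nu> \<in> M" "(\<integral>t. \<phi> n t \<partial>\<nu>) = 0" "(\<integral>t. h t \<partial>\<nu>) \<le> 0" by (auto simp: S_def)
  then show ?case by (auto simp: M_def less_Suc_eq)
qed

text \<open>
  The Bernstein polynomials with rational coefficients are dense among the continuous functions; a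
  countable subset of \<open>V\<close> itself is obtained by choosing, for each of them and each accuracy, one
  member of \<open>V\<close> nearby.
\<close>

lemma countable_uniformly_dense_subset:
  fixes V :: "(real \<Rightarrow> real) set"
  assumes "\<And>\<phi>. \<phi> \<in> V \<Longrightarrow> continuous_on {0..1} \<phi>"
  obtains V0 where "V0 \<subseteq> V" "countable V0"
    "\<And>\<phi> e. \<phi> \<in> V \<Longrightarrow> e > 0 \<Longrightarrow> \<exists>\<psi>\<in>V0. \<forall>t\<in>{0..1}. \<bar>\<phi> t - \<psi> t\<bar> < e"
proof -
  define D where "D n xs t = (\<Sum>k\<le>n. of_rat (xs ! k) * Bernstein n k t)" for n and xs :: "rat list" and t
  define near where "near m n xs \<psi> \<longleftrightarrow> \<psi> \<in> V \<and> (\<forall>t\<in>{0..1}. \<bar>\<psi> t - D n xs t\<bar> < 1 / Suc m)"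
    for m n :: nat and xs \<psi>
  define pick where "pick = (\<lambda>(m, n, xs). SOME \<psi>. near m n xs \<psi>)"
  define V0 where "V0 = range pick \<inter> V"
  have "\<exists>\<psi>\<in>V0. \<forall>t\<in>{0..1}. \<bar>\<phi> t - \<psi> t\<bar> < e" if \<phi>: "\<phi> \<in> V" and e: "e > 0" for \<phi> e
  proof -
    obtain m :: nat where m: "1 / Suc m < e / 2" using e
      by (metis half_gt_zero nat_approx_posE)
    define d where "d = 1 / (2 * real (Suc m))"
    have d: "d > 0" "d + d = 1 / Suc m" by (auto simp: d_def field_simps)
    obtain n where n: "\<And>t. t \<in> {0..1} \<Longrightarrow> \<bar>\<phi> t - (\<Sum>k\<le>n. \<phi> (k / n) * Bernstein n k t)\<bar> < d"
      using Bernstein_Weierstrass[OF assms[OF \<phi>] d(1)] by blast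
    have "\<exists>r::rat. \<bar>of_rat r - y\<bar> < d" for y :: real
      using of_rat_dense[of "y - d" "y + d"] d by (auto simp: abs_less_iff) (smt (verit))
    then obtain q :: "real \<Rightarrow> rat" where q: "\<And>y. \<bar>of_rat (q y) - y\<bar> < d" by metis
    define xs where "xs = map (\<lambda>k. q (\<phi> (real k / n))) [0..<Suc n]"
    have xs: "xs ! k = q (\<phi> (real k / n))" if "k \<le> n" for k
      using that unfolding xs_def by (subst nth_map) (auto simp del: upt_Suc)
    have "near m n xs \<phi>" unfolding near_def
    proof (intro conjI ballI \<phi>)
      fix t :: real assume t: "t \<in> {0..1}"
      have "\<bar>(\<Sum>k\<le>n. \<phi> (k / n) * Bernstein n k t) - D n xs t\<bar>
          = \<bar>\<Sum>k\<le>n. (\<phi> (k / n) - of_rat (xs ! k)) * Bernstein n k t\<bar>"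
        by (simp add: D_def left_diff_distrib sum_subtractf)
      also have "\<dots> \<le> (\<Sum>k\<le>n. \<bar>(\<phi> (k / n) - of_rat (xs ! k)) * Bernstein n k t\<bar>)" by (rule sum_abs)
      also have "\<dots> \<le> (\<Sum>k\<le>n. d * Bernstein n k t)"
      proof (rule sum_mono)
        fix k assume k: "k \<in> {..n}"
        have "\<bar>\<phi> (k / n) - of_rat (xs ! k)\<bar> \<le> d"
          using q[of "\<phi> (k / n)"] k xs[of k] by (simp add: abs_minus_commute less_imp_le)
        then show "\<bar>(\<phi> (k / n) - of_rat (xs ! k)) * Bernstein n k t\<bar> \<le> d * Bernstein n k t"
          using t Bernstein_nonneg[of t n k] by (simp add: abs_mult mult_right_mono)
      qed
      also have "\<dots> = d" by (simp flip: sum_distrib_left)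
      finally show "\<bar>\<phi> t - D n xs t\<bar> < 1 / Suc m" using n[OF t] d(2) by linarith
    qed
    then have p: "near m n xs (pick (m, n, xs))" unfolding pick_def prod.case by (rule someI[of "near m n xs" \<phi>])
    show ?thesis
    proof (intro bexI[of _ "pick (m, n, xs)"] ballI)
      fix t :: real assume t: "t \<in> {0..1}"
      have "\<bar>pick (m, n, xs) t - D n xs t\<bar> < 1 / Suc m" "\<bar>\<phi> t - D n xs t\<bar> < 1 / Suc m"
        using p \<open>near m n xs \<phi>\<close> t by (auto simp: near_def)
      then show "\<bar>\<phi> t - pick (m, n, xs) t\<bar> < e" using m by linarith
    qed (use p in \<open>auto simp: V0_def near_def\<close>)
  qed
  then show thesis by (intro that[of V0]) (auto simp: V0_def)
qed

text \<open>
  A sequence of measures satisfying more and more of a countable dense family of constraints has a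
  limit point, which satisfies all of them.
\<close>

lemma duality_on_line:
  assumes T: "compact T" "T \<subseteq> {0..1}"
    and V: "\<And>\<phi>. \<phi> \<in> V \<Longrightarrow> bounded_continuous \<phi>" "(\<lambda>t. 0) \<in> V"
      "\<And>\<phi> \<psi> c. \<phi> \<in> V \<Longrightarrow> \<psi> \<in> V \<Longrightarrow> (\<lambda>t. \<phi> t + c * \<psi> t) \<in> V"
    and h: "bounded_continuous h"
    and alt: "\<And>\<phi>. \<phi> \<in> V \<Longrightarrow> \<exists>t\<in>T. h t \<le> \<phi> t"
  shows "\<exists>\<nu>\<in>distributions_on T. (\<forall>\<phi>\<in>V. (\<integral>t. \<phi> t \<partial>\<nu>) = 0) \<and> (\<integral>t. h t \<partial>\<nu>) \<le> 0"
proof -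
  obtain V0 where V0: "V0 \<subseteq> V" "countable V0"
    and dense: "\<And>\<phi> e. \<phi> \<in> V \<Longrightarrow> e > 0 \<Longrightarrow> \<exists>\<psi>\<in>V0. \<forall>t\<in>{0..1}. \<bar>\<phi> t - \<psi> t\<bar> < e"
    by (rule countable_uniformly_dense_subset[of V])
       (use V(1) in \<open>auto simp: bounded_continuous_def intro: continuous_on_subset\<close>)
  have "V0 \<noteq> {}" using dense[OF V(2), of 1] by auto
  then have range: "range (from_nat_into V0) = V0" using V0(2) by (rule range_from_nat_into)
  then have en: "from_nat_into V0 i \<in> V" for i using V0(1) by blast
  have "\<exists>\<nu>\<in>distributions_on T. (\<forall>i<n. (\<integral>t. from_nat_into V0 i t \<partial>\<nu>) = 0) \<and> (\<integral>t. h t \<partial>\<nu>) \<le> 0" for n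
  proof (rule finite_duality[OF T(1) _ h])
    fix c :: "nat \<Rightarrow> real"
    have "(\<lambda>t. \<Sum>i<n. c i * from_nat_into V0 i t) \<in> V"
      by (induction n) (auto intro!: V(2) V(3) en)
    then show "\<exists>t\<in>T. h t \<le> (\<Sum>i<n. c i * from_nat_into V0 i t)" by (rule alt)
  qed (use en V(1) in auto)
  then obtain \<nu> where \<nu>: "\<And>n. \<nu> n \<in> distributions_on T" "\<And>n. (\<integral>t. h t \<partial>\<nu> n) \<le> 0"
    "\<And>n i. i < n \<Longrightarrow> (\<integral>t. from_nat_into V0 i t \<partial>\<nu> n) = 0" by metis
  obtain r \<nu>' where r: "strict_mono (r :: nat \<Rightarrow> nat)" and \<nu>': "\<nu>' \<in> distributions_on T"
    and conv: "\<And>f. bounded_continuous f \<Longrightarrow> (\<lambda>n. \<integral>t. f t \<partial>\<nu> (r n)) \<longlonglongrightarrow> (\<integral>t. f t \<partial>\<nu>')"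
    by (rule distributions_on_seq_compact[where \<nu> = \<nu>, OF T(1) \<nu>(1)]) blast
  have 0: "(\<integral>t. \<psi> t \<partial>\<nu>') = 0" if "\<psi> \<in> V0" for \<psi>
  proof -
    from that range obtain i where i: "\<psi> = from_nat_into V0 i" by blast
    have "\<forall>\<^sub>F n in sequentially. (\<integral>t. \<psi> t \<partial>\<nu> (r n)) = 0"
      using eventually_gt_at_top[of i]
    proof eventually_elim
      case (elim n)
      then have "i < r n" using seq_suble[OF r, of n] by linarith
      then show ?case using \<nu>(3) i by simp
    qed
    moreover have "(\<lambda>n. \<integral>t. \<psi> t \<partial>\<nu> (r n)) \<longlonglongrightarrow> (\<integral>t. \<psi> t \<partial>\<nu>')"
      using that V0 V(1) by (intro conv) auto
    ultimately have "(\<lambda>n. 0) \<longlonglongrightarrow> (\<integral>t. \<psi> t \<partial>\<nu>')" by (rule Lim_transform_eventually[rotated])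
    then show ?thesis by (simp add: LIMSEQ_const_iff)
  qed
  have "(\<integral>t. \<phi> t \<partial>\<nu>') = 0" if \<phi>: "\<phi> \<in> V" for \<phi>
  proof -
    have "\<bar>\<integral>t. \<phi> t \<partial>\<nu>'\<bar> \<le> e" if e: "e > 0" for e
    proof -
      obtain \<psi> where \<psi>: "\<psi> \<in> V0" "\<And>t. t \<in> {0..1} \<Longrightarrow> \<bar>\<phi> t - \<psi> t\<bar> < e"
        using dense[OF \<phi> e] by blast
      have bc: "bounded_continuous \<phi>" "bounded_continuous \<psi>" using \<psi> V0 V(1) \<phi> by auto
      have int: "integrable \<nu>' \<phi>" "integrable \<nu>' \<psi>"
        using bc by (auto intro: distributions_on_integrable[OF \<nu>'])
      have "(\<integral>t. \<phi> t - 1 * \<psi> t \<partial>\<nu>') \<le> e" "(\<integral>t. \<psi> t - 1 * \<phi> t \<partial>\<nu>') \<le> e"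
        using \<psi>(2) T(2)
        by (intro distributions_on_integral_bound[OF \<nu>'] bounded_continuous_diff bc; force simp: abs_less_iff)+
      then show ?thesis using int 0[OF \<psi>(1)] by simp
    qed
    then show ?thesis by (metis abs_le_zero_iff field_le_epsilon add_0)
  qed
  moreover have "(\<integral>t. h t \<partial>\<nu>') \<le> 0"
    using conv[OF h] \<nu>(2) by (intro LIMSEQ_le_const2) auto
  ultimately show ?thesis using \<nu>' by blast
qed

text \<open>
  Transport of the alternative to an arbitrary compact set along a curve that covers it.  The curve
  is made constant on both sides of \<open>[0, 1]\<close>, so that continuous functions become bounded ones on the whole line.
\<close>

theorem measure_duality:
  fixes K :: "'a::euclidean_space set" and V :: "('a \<Rightarrow> real) set"
  assumes K: "compact K"
    and V: "\<And>\<phi>. \<phi> \<in> V \<Longrightarrow> continuous_on UNIV \<phi>" "(\<lambda>x. 0) \<in> V"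
      "\<And>\<phi> \<psi> c. \<phi> \<in> V \<Longrightarrow> \<psi> \<in> V \<Longrightarrow> (\<lambda>x. \<phi> x + c * \<psi> x) \<in> V"
    and h: "continuous_on UNIV h"
    and alt: "\<And>\<phi>. \<phi> \<in> V \<Longrightarrow> \<exists>x\<in>K. h x \<le> \<phi> x"
  obtains \<mu> where "prob_space \<mu>" "sets \<mu> = sets borel" "AE x in \<mu>. x \<in> K"
    "\<And>\<phi>. \<phi> \<in> V \<Longrightarrow> (\<integral>x. \<phi> x \<partial>\<mu>) = 0" "(\<integral>x. h x \<partial>\<mu>) \<le> 0"
proof -
  obtain a where a: "K \<subseteq> cbox (- a) a" using bounded_subset_cbox_symmetric[OF compact_imp_bounded[OF K]] by blast
  obtain \<gamma>0 :: "real \<Rightarrow> 'a" where \<gamma>0: "continuous_on UNIV \<gamma>0" "cbox (- a) a \<subseteq> \<gamma>0 ` {0..1}"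
    by (rule space_filling_curve)
  define \<gamma> where "\<gamma> t = \<gamma>0 (max 0 (min 1 t))" for t
  have \<gamma>: "continuous_on UNIV \<gamma>" unfolding \<gamma>_def
    by (intro continuous_on_compose2[OF \<gamma>0(1)] continuous_intros) auto
  have \<gamma>_eq: "\<gamma> t = \<gamma>0 t" if "t \<in> {0..1}" for t using that by (simp add: \<gamma>_def)
  define T where "T = {0..1} \<inter> \<gamma> -` K"
  have bc: "bounded_continuous (\<lambda>t. f (\<gamma> t))" if f: "continuous_on UNIV f" for f :: "'a \<Rightarrow> real"
  proof -
    have c: "continuous_on UNIV (\<lambda>t. f (\<gamma> t))" by (intro continuous_on_compose2[OF f \<gamma>]) auto
    have "bounded ((\<lambda>t. f (\<gamma>0 t)) ` {0..1})"
      by (intro compact_imp_bounded compact_continuous_image continuous_on_compose2[OF f] continuous_on_subset[OF \<gamma>0(1)]) auto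
    then have "bounded (range (\<lambda>t. f (\<gamma> t)))"
      by (rule bounded_subset) (auto simp: \<gamma>_def)
    with c show ?thesis by (simp add: bounded_continuous_def)
  qed
  have T: "compact T" "T \<subseteq> {0..1}"
    using closed_vimage[OF compact_imp_closed[OF K] \<gamma>] by (auto simp: T_def intro!: compact_Int_closed)
  have "\<exists>\<nu>\<in>distributions_on T. (\<forall>\<phi>\<in>(\<lambda>\<phi> t. \<phi> (\<gamma> t)) ` V. (\<integral>t. \<phi> t \<partial>\<nu>) = 0) \<and> (\<integral>t. h (\<gamma> t) \<partial>\<nu>) \<le> 0"
  proof (rule duality_on_line[OF T _ _ _ bc[OF h]])
    fix \<phi> assume "\<phi> \<in> (\<lambda>\<phi> t. \<phi> (\<gamma> t)) ` V"
    then obtain \<psi> where \<psi>: "\<psi> \<in> V" "\<phi> = (\<lambda>t. \<psi> (\<gamma> t))" by auto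
    then show "bounded_continuous \<phi>" using bc V(1) by auto
    obtain x where x: "x \<in> K" "h x \<le> \<psi> x" using alt[OF \<psi>(1)] by auto
    then obtain t where "t \<in> {0..1}" "x = \<gamma>0 t" using a \<gamma>0(2) by blast
    then show "\<exists>t\<in>T. h (\<gamma> t) \<le> \<phi> t" using x \<psi>(2) \<gamma>_eq[of t] by (intro bexI[of _ t]) (auto simp: T_def)
  next
    fix \<phi> \<psi> c assume "\<phi> \<in> (\<lambda>\<phi> t. \<phi> (\<gamma> t)) ` V" "\<psi> \<in> (\<lambda>\<phi> t. \<phi> (\<gamma> t)) ` V"
    then obtain \<phi>' \<psi>' where "\<phi>' \<in> V" "\<phi> = (\<lambda>t. \<phi>' (\<gamma> t))" "\<psi>' \<in> V" "\<psi> = (\<lambda>t. \<psi>' (\<gamma> t))" by auto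
    then show "(\<lambda>t. \<phi> t + c * \<psi> t) \<in> (\<lambda>\<phi> t. \<phi> (\<gamma> t)) ` V"
      using V(3)[of \<phi>' \<psi>' c] by (auto intro!: image_eqI[of _ _ "\<lambda>x. \<phi>' x + c * \<psi>' x"])
  qed (use V(2) in \<open>auto intro!: image_eqI[of _ _ "\<lambda>x. 0"]\<close>)
  then obtain \<nu> where \<nu>: "\<nu> \<in> distributions_on T"
    "\<And>\<phi>. \<phi> \<in> V \<Longrightarrow> (\<integral>t. \<phi> (\<gamma> t) \<partial>\<nu>) = 0" "(\<integral>t. h (\<gamma> t) \<partial>\<nu>) \<le> 0" by auto
  interpret real_distribution \<nu> using \<nu> by (simp add: distributions_on_def)
  have m: "\<gamma> \<in> measurable \<nu> borel" using borel_measurable_continuous_onI[OF \<gamma>] by simp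
  have integ: "(\<integral>x. f x \<partial>distr \<nu> borel \<gamma>) = (\<integral>t. f (\<gamma> t) \<partial>\<nu>)" if "continuous_on UNIV f" for f :: "'a \<Rightarrow> real"
    using borel_measurable_continuous_onI[OF that] by (rule integral_distr[OF m])
  show thesis
  proof
    show "prob_space (distr \<nu> borel \<gamma>)" by (rule prob_space_distr[OF m])
    have "AE t in \<nu>. \<gamma> t \<in> K" using \<nu>(1) by (auto simp: distributions_on_def T_def)
    then show "AE x in distr \<nu> borel \<gamma>. x \<in> K"
      using borel_compact[OF K] by (subst AE_distr_iff[OF m]) (auto simp: Collect_mem_eq)
  qed (use \<nu> integ V(1) h in auto)
qed

section \<open>Superlinear Hamiltonians and their Lagrangians\<close>

text \<open>
  The supporting hyperplane of the epigraph at a boundary point is not vertical, since the function is finite everywhere.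
\<close>

lemma convex_on_subgradient:
  fixes f :: "'a::euclidean_space \<Rightarrow> real"
  assumes "convex_on UNIV f"
  obtains g where "\<And>y. f x + g \<bullet> (y - x) \<le> f y"
proof -
  let ?E = "epigraph UNIV f"
  have E: "convex ?E" using assms by (simp add: convex_epigraph)
  have mem: "(y, t) \<in> ?E \<longleftrightarrow> f y \<le> t" for y t by (simp add: epigraph_def)
  have "(x, f x) \<notin> rel_interior ?E"
  proof
    assume "(x, f x) \<in> rel_interior ?E"
    then obtain e where e: "e > 0" "cball (x, f x) e \<inter> affine hull ?E \<subseteq> ?E"
      by (auto simp: mem_rel_interior_cball)
    have "(x, f x) \<in> affine hull ?E" "(x, f x + e) \<in> affine hull ?E"
      using e(1) by (auto intro!: hull_inc simp: mem)
    then have "2 *\<^sub>R (x, f x) + (- 1) *\<^sub>R (x, f x + e) \<in> affine hull ?E"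
      using affine_affine_hull by (intro mem_affine) auto
    moreover have "2 *\<^sub>R (x, f x) + (- 1) *\<^sub>R (x, f x + e) = (x, f x - e)"
      by (simp add: algebra_simps flip: scaleR_2)
    ultimately have "(x, f x - e) \<in> affine hull ?E" by simp
    moreover have "(x, f x - e) \<in> cball (x, f x) e" using e(1) by (simp add: dist_Pair_Pair dist_real_def)
    ultimately have "(x, f x - e) \<in> ?E" using e(2) by blast
    with e(1) show False by (simp add: mem)
  qed
  moreover have "(x, f x) \<in> ?E" by (simp add: mem)
  ultimately obtain c where c: "c \<noteq> 0" "\<And>w. w \<in> ?E \<Longrightarrow> c \<bullet> (x, f x) \<le> c \<bullet> w"
    using supporting_hyperplane_rel_boundary[OF E] by metis
  obtain a b where ab: "c = (a, b)" by (cases c)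
  have supp: "0 \<le> a \<bullet> (y - x) + b * (t - f x)" if "f y \<le> t" for y t
    using c(2)[of "(y, t)"] that by (simp add: mem ab inner_diff_right right_diff_distrib)
  have "b \<ge> 0" using supp[of x "f x + 1"] by simp
  moreover have "b \<noteq> 0"
  proof
    assume "b = 0"
    then have "a \<bullet> a \<le> 0" using supp[of "x - a" "f (x - a)"] by simp
    then have "a = 0" by (metis inner_ge_zero antisym inner_eq_zero_iff)
    with c(1) ab \<open>b = 0\<close> show False by (simp add: zero_prod_def)
  qed
  ultimately have b: "b > 0" by simp
  show thesis
  proof (rule that[of "- (1 / b) *\<^sub>R a"])
    fix y
    have "b * f x - a \<bullet> (y - x) \<le> b * f y" using supp[of y "f y"] by (simp add: algebra_simps)
    then show "f x + (- (1 / b) *\<^sub>R a) \<bullet> (y - x) \<le> f y" using b by (simp add: field_simps)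
  qed
qed

text \<open>
  A sequence of momenta violating the bound has norms tending to infinity.  By convexity the violation
  persists at every point of the segments from 0 to these momenta, hence in the limit along a whole
  ray at a limit point \<open>x0\<close>, against superlinearity at \<open>x0\<close>.
\<close>

lemma superlinear_uniformly_on_compact:
  fixes H :: "'a::euclidean_space \<Rightarrow> 'b::euclidean_space \<Rightarrow> real"
  assumes cont: "continuous_on UNIV (\<lambda>(x, p). H x p)"
    and conv: "\<And>x. convex_on UNIV (H x)"
    and superlinear: "\<And>x. filterlim (\<lambda>p. H x p / norm p) at_top at_infinity"
    and X: "compact X"
  obtains r where "r > 0" "\<And>x p. x \<in> X \<Longrightarrow> norm p \<ge> r \<Longrightarrow> H x 0 + A * norm p \<le> H x p"
proof (rule ccontr)
  assume neg: "\<not> thesis"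
  have "\<exists>x p. x \<in> X \<and> norm p \<ge> real (Suc n) \<and> H x p < H x 0 + A * norm p" for n
  proof (rule ccontr)
    assume "\<not> ?thesis"
    then have "\<And>x p. x \<in> X \<Longrightarrow> norm p \<ge> real (Suc n) \<Longrightarrow> H x 0 + A * norm p \<le> H x p"
      by (metis not_le)
    then have thesis by (rule that[rotated]) auto
    with neg show False by simp
  qed
  then obtain x p where xp: "\<And>n. x n \<in> X" "\<And>n. norm (p n) \<ge> real (Suc n)"
    "\<And>n. H (x n) (p n) < H (x n) 0 + A * norm (p n)" by metis
  define e where "e n = (1 / norm (p n)) *\<^sub>R p n" for n
  have np: "norm (p n) > 0" for n using xp(2)[of n] by linarith
  have in_S: "\<forall>n. (x n, e n) \<in> X \<times> sphere 0 1" using xp(1) np by (auto simp: e_def less_le)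
  have "seq_compact (X \<times> sphere (0::'b) 1)" using X by (intro compact_imp_seq_compact compact_Times) auto
  then obtain l s where s: "strict_mono (s :: nat \<Rightarrow> nat)" "l \<in> X \<times> sphere 0 1"
    "((\<lambda>n. (x n, e n)) \<circ> s) \<longlonglongrightarrow> l" using in_S by (elim seq_compactE[where f = "\<lambda>n. (x n, e n)"]) auto
  obtain x0 e0 where l: "l = (x0, e0)" by (cases l)
  have lim: "(\<lambda>n. x (s n)) \<longlonglongrightarrow> x0" "(\<lambda>n. e (s n)) \<longlonglongrightarrow> e0" and e0: "norm e0 = 1"
    using s(2) tendsto_fst[OF s(3)] tendsto_snd[OF s(3)] by (auto simp: l o_def)
  have limH: "(\<lambda>n. H (y n) (q n)) \<longlonglongrightarrow> H y0 q0" if "y \<longlonglongrightarrow> y0" "q \<longlonglongrightarrow> q0" for y q y0 q0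
    using isCont_tendsto_compose[of "(y0, q0)" "\<lambda>(x, p). H x p" "\<lambda>n. (y n, q n)"] cont tendsto_Pair[OF that]
    by (simp add: continuous_on_eq_continuous_at)
  have ray: "H x0 (\<rho> *\<^sub>R e0) \<le> H x0 0 + A * \<rho>" if \<rho>: "\<rho> > 0" for \<rho>
  proof (rule LIMSEQ_le)
    show "(\<lambda>n. H (x (s n)) (\<rho> *\<^sub>R e (s n))) \<longlonglongrightarrow> H x0 (\<rho> *\<^sub>R e0)"
      by (intro limH lim tendsto_intros)
    show "(\<lambda>n. H (x (s n)) 0 + A * \<rho>) \<longlonglongrightarrow> H x0 0 + A * \<rho>"
      by (intro limH lim tendsto_intros)
    show "\<exists>N. \<forall>n\<ge>N. H (x (s n)) (\<rho> *\<^sub>R e (s n)) \<le> H (x (s n)) 0 + A * \<rho>"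
    proof (intro exI allI impI)
      fix n assume n: "nat \<lceil>\<rho>\<rceil> \<le> n"
      define k where "k = s n"
      have "\<rho> \<le> real n" using n by linarith
      also have "real n \<le> real (Suc k)" using seq_suble[OF s(1), of n] by (simp add: k_def)
      also have "\<dots> \<le> norm (p k)" by (rule xp)
      finally have le: "\<rho> \<le> norm (p k)" .
      define \<theta> where "\<theta> = \<rho> / norm (p k)"
      have \<theta>: "0 \<le> \<theta>" "\<theta> \<le> 1" "\<theta> * norm (p k) = \<rho>" using \<rho> le np[of k] by (auto simp: \<theta>_def)
      have "H (x k) (\<theta> *\<^sub>R p k) \<le> (1 - \<theta>) * H (x k) 0 + \<theta> * H (x k) (p k)"
        using convex_onD[OF conv[of "x k"] \<theta>(1,2), of 0 "p k"] by simp
      also have "\<dots> \<le> (1 - \<theta>) * H (x k) 0 + \<theta> * (H (x k) 0 + A * norm (p k))"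
        using \<theta> xp(3)[of k] by (intro add_left_mono mult_left_mono) auto
      also have "\<dots> = H (x k) 0 + A * (\<theta> * norm (p k))" by (simp add: algebra_simps)
      finally show "H (x (s n)) (\<rho> *\<^sub>R e (s n)) \<le> H (x (s n)) 0 + A * \<rho>"
        using \<theta>(3) by (simp add: k_def e_def \<theta>_def)
    qed
  qed
  obtain b where b: "\<And>p. norm p \<ge> b \<Longrightarrow> A + 1 + \<bar>H x0 0\<bar> \<le> H x0 p / norm p"
    using superlinear[of x0] unfolding filterlim_at_top eventually_at_infinity by blast
  define \<rho> where "\<rho> = max b 1"
  have \<rho>: "\<rho> \<ge> 1" "\<rho> \<ge> b" by (auto simp: \<rho>_def)
  have "A + 1 + \<bar>H x0 0\<bar> \<le> H x0 (\<rho> *\<^sub>R e0) / \<rho>"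
    using b[of "\<rho> *\<^sub>R e0"] \<rho> e0 by simp
  then have "(A + 1 + \<bar>H x0 0\<bar>) * \<rho> \<le> H x0 (\<rho> *\<^sub>R e0)" using \<rho> by (simp add: field_simps)
  also have "\<dots> \<le> H x0 0 + A * \<rho>" using ray \<rho> by simp
  finally have "\<rho> + \<bar>H x0 0\<bar> * \<rho> \<le> H x0 0" by (simp add: algebra_simps)
  moreover have "\<bar>H x0 0\<bar> * 1 \<le> \<bar>H x0 0\<bar> * \<rho>" using \<rho> by (intro mult_left_mono) auto
  ultimately show False using \<rho> by linarith
qed

locale superlinear_hamiltonian =
  fixes H :: "real^'n \<Rightarrow> real^'n \<Rightarrow> real"
  assumes continuous: "continuous_on UNIV (\<lambda>(x, p). H x p)"
    and convex: "\<And>x. convex_on UNIV (H x)"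
    and superlinear: "\<And>x. filterlim (\<lambda>p. H x p / norm p) at_top at_infinity"
begin

lemma continuous_compose [continuous_intros]:
  "continuous_on S f \<Longrightarrow> continuous_on S g \<Longrightarrow> continuous_on S (\<lambda>w. H (f w) (g w))"
  using continuous_on_compose2[OF continuous, of S "\<lambda>w. (f w, g w)"] by (auto intro: continuous_on_Pair)

lemma uniformly_superlinear:
  assumes "compact X"
  obtains r where "r > 0" "\<And>x p. x \<in> X \<Longrightarrow> norm p \<ge> r \<Longrightarrow> H x 0 + A * norm p \<le> H x p"
  by (rule superlinear_uniformly_on_compact[OF continuous convex superlinear assms]) (rule that)

lemma bounded_on_compact:
  assumes "compact X"
  obtains B where "\<And>x p. x \<in> X \<Longrightarrow> norm p \<le> M \<Longrightarrow> \<bar>H x p\<bar> \<le> B"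
proof -
  have "compact ((\<lambda>w. H (fst w) (snd w)) ` (X \<times> cball 0 M))"
    by (intro compact_continuous_image continuous_intros compact_Times assms compact_cball)
  from compact_imp_bounded[OF this] obtain B where
    "\<forall>y\<in>(\<lambda>w. H (fst w) (snd w)) ` (X \<times> cball 0 M). norm y \<le> B" by (auto simp: bounded_iff)
  then show thesis by (intro that[of B]) force
qed

lemma bounded_below:
  assumes "compact X"
  obtains m where "\<And>x p. x \<in> X \<Longrightarrow> m \<le> H x p"
proof -
  obtain r where r: "\<And>x p. x \<in> X \<Longrightarrow> norm p \<ge> r \<Longrightarrow> H x 0 + 0 * norm p \<le> H x p"
    using uniformly_superlinear[OF assms] by metis
  obtain B where B: "\<And>x p. x \<in> X \<Longrightarrow> norm p \<le> max r 0 \<Longrightarrow> \<bar>H x p\<bar> \<le> B"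
    using bounded_on_compact[OF assms] by metis
  show thesis
  proof (rule that[of "- B"])
    fix x p :: "real^'n" assume x: "x \<in> X"
    show "- B \<le> H x p"
      using r[OF x, of p] B[OF x, of p] B[OF x, of 0] by (cases "norm p \<ge> r") (auto simp: abs_le_iff le_max_iff_disj)
  qed
qed

text \<open>
  For velocities in a ball, only the momenta of a fixed ball matter in the definition of \<open>L\<close>: beyond
  it, the momentum 0 does better.
\<close>

lemma dual_maximizer_bounded:
  assumes "compact X"
  obtains r where "\<And>x q p. x \<in> X \<Longrightarrow> norm q \<le> R \<Longrightarrow> \<exists>p'\<in>cball 0 r. p \<bullet> q - H x p \<le> p' \<bullet> q - H x p'"
proof -
  obtain r where r: "r > 0" "\<And>x p. x \<in> X \<Longrightarrow> norm p \<ge> r \<Longrightarrow> H x 0 + R * norm p \<le> H x p"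
    using uniformly_superlinear[OF assms] by metis
  show thesis
  proof (rule that[of r])
    fix x q p :: "real^'n" assume x: "x \<in> X" and q: "norm q \<le> R"
    show "\<exists>p'\<in>cball 0 r. p \<bullet> q - H x p \<le> p' \<bullet> q - H x p'"
    proof (cases "norm p \<ge> r")
      case True
      have "p \<bullet> q \<le> norm p * norm q" by (rule norm_cauchy_schwarz)
      also have "\<dots> \<le> norm p * R" using q by (intro mult_left_mono) auto
      finally have "p \<bullet> q - H x p \<le> 0 \<bullet> q - H x 0" using r(2)[OF x True] by (simp add: mult.commute)
      then show ?thesis using r by (intro bexI[of _ 0]) auto
    qed (auto intro!: bexI[of _ p])
  qed
qed

lemma fenchel_inequality: "p \<bullet> q - H x p \<le> lagrangian H (x, q)"
proof -
  obtain r where "\<And>y q' p. y \<in> {x} \<Longrightarrow> norm q' \<le> norm q \<Longrightarrow> \<exists>p'\<in>cball 0 r. p \<bullet> q' - H y p \<le> p' \<bullet> q' - H y p'"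
    by (rule dual_maximizer_bounded[of "{x}" "norm q"]) auto
  then have r: "\<And>p. \<exists>p'\<in>cball 0 r. p \<bullet> q - H x p \<le> p' \<bullet> q - H x p'" by blast
  have "compact ((\<lambda>p. p \<bullet> q - H x p) ` cball 0 r)"
    by (intro compact_continuous_image continuous_intros compact_cball)
  then have "bdd_above ((\<lambda>p. p \<bullet> q - H x p) ` cball 0 r)"
    by (intro bounded_imp_bdd_above compact_imp_bounded)
  then obtain B where B: "\<forall>b\<in>(\<lambda>p. p \<bullet> q - H x p) ` cball 0 r. b \<le> B"
    unfolding bdd_above_def by blast
  have "p \<bullet> q - H x p \<le> B" for p
    using r[of p] B by (meson imageI order_trans)
  then have "bdd_above (range (\<lambda>p. p \<bullet> q - H x p))" by (intro bdd_aboveI2)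
  then show ?thesis unfolding lagrangian_def prod.case by (rule cSUP_upper[OF UNIV_I])
qed

lemma lagrangian_le: "(\<And>p. p \<bullet> q - H x p \<le> c) \<Longrightarrow> lagrangian H (x, q) \<le> c"
  unfolding lagrangian_def prod.case by (rule cSUP_least) auto

text \<open>
  Locally \<open>L\<close> is a supremum over one compact set of momenta of a uniformly equicontinuous family.
\<close>

lemma continuous_lagrangian: "continuous_on UNIV (lagrangian H)"
  unfolding continuous_on_iff
proof (intro ballI allI impI)
  fix w :: "(real^'n) \<times> (real^'n)" and e :: real assume e: "e > 0"
  obtain x0 q0 where w: "w = (x0, q0)" by (cases w)
  define X where "X = cball x0 1"
  define Q where "Q = cball q0 1"
  obtain r where r: "\<And>x q p. x \<in> X \<Longrightarrow> norm q \<le> norm q0 + 1 \<Longrightarrow> \<exists>p'\<in>cball 0 r. p \<bullet> q - H x p \<le> p' \<bullet> q - H x p'"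
    using dual_maximizer_bounded[of X "norm q0 + 1"] by (auto simp: X_def)
  have nq: "norm q \<le> norm q0 + 1" if "q \<in> Q" for q
    using that norm_triangle_sub[of q q0] by (simp add: Q_def dist_norm norm_minus_commute)
  define F where "F w = snd w \<bullet> snd (fst w) - H (fst (fst w)) (snd w)" for w
  have "continuous_on ((X \<times> Q) \<times> cball 0 r) F"
    unfolding F_def by (intro continuous_intros)
  moreover have "compact ((X \<times> Q) \<times> cball (0::real^'n) r)"
    unfolding X_def Q_def by (intro compact_Times compact_cball)
  ultimately have uc: "uniformly_continuous_on ((X \<times> Q) \<times> cball 0 r) F"
    by (rule compact_uniformly_continuous)
  obtain d where d: "d > 0" "\<And>u v. u \<in> (X \<times> Q) \<times> cball 0 r \<Longrightarrow> v \<in> (X \<times> Q) \<times> cball 0 r \<Longrightarrow>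
      dist v u < d \<Longrightarrow> dist (F v) (F u) < e / 2"
    by (rule uniformly_continuous_onE[OF uc half_gt_zero[OF e]]) (rule that)
  have half: "lagrangian H (x, q) \<le> lagrangian H (x', q') + e / 2"
    if xq: "x \<in> X" "q \<in> Q" "x' \<in> X" "q' \<in> Q" "dist (x, q) (x', q') < d" for x q x' q'
  proof (rule lagrangian_le)
    fix p
    obtain p' where p': "p' \<in> cball 0 r" "p \<bullet> q - H x p \<le> p' \<bullet> q - H x p'"
      using r[OF xq(1) nq[OF xq(2)]] by blast
    have "dist (F ((x, q), p')) (F ((x', q'), p')) < e / 2"
      using xq p' by (intro d(2)) (auto simp: dist_Pair_Pair)
    then have "p' \<bullet> q - H x p' \<le> p' \<bullet> q' - H x' p' + e / 2"
      unfolding dist_real_def F_def fst_conv snd_conv by linarith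
    then show "p \<bullet> q - H x p \<le> lagrangian H (x', q') + e / 2"
      using p' fenchel_inequality[of p' q' x'] by linarith
  qed
  show "\<exists>d>0. \<forall>w'\<in>UNIV. dist w' w < d \<longrightarrow> dist (lagrangian H w') (lagrangian H w) < e"
  proof (intro exI[of _ "min d 1"] conjI ballI impI)
    fix w' assume w': "dist w' w < min d 1"
    obtain x q where xq: "w' = (x, q)" by (cases w')
    have "dist x x0 \<le> dist w' w" "dist q q0 \<le> dist w' w"
      using dist_fst_le[of w' w] dist_snd_le[of w' w] by (auto simp: xq w)
    then have "x \<in> X" "q \<in> Q" "x0 \<in> X" "q0 \<in> Q" using w' by (auto simp: X_def Q_def dist_commute)
    moreover have "dist (x, q) (x0, q0) < d" "dist (x0, q0) (x, q) < d"
      using w' by (simp_all add: xq w dist_commute)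
    ultimately have "lagrangian H (x, q) \<le> lagrangian H (x0, q0) + e / 2"
      "lagrangian H (x0, q0) \<le> lagrangian H (x, q) + e / 2" by - (intro half; assumption)+
    then show "dist (lagrangian H w') (lagrangian H w) < e"
      using e unfolding xq w dist_real_def by linarith
  qed (use d in auto)
qed

text \<open>
  Since \<open>H\<close> is the conjugate of \<open>L\<close>, the inequality \<open>H x p \<le> a\<close> amounts to the linear inequalities over
  all velocities \<open>q\<close>, and only the subgradients of \<open>H x\<close> at \<open>p\<close> are relevant.  They are bounded while
  \<open>p\<close> stays in a ball on whose sphere \<open>H x > A\<close>.  For \<open>p\<close> outside this ball the hypothesis already
  fails for a subgradient at the point of the sphere on the same ray.
\<close>

lemma bounded_velocities_suffice:
  assumes X: "compact X" and A: "\<And>x. x \<in> X \<Longrightarrow> H x 0 \<le> A"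
  obtains R where "R > 0"
    "\<And>x p a. x \<in> X \<Longrightarrow> a \<le> A \<Longrightarrow> (\<And>q. norm q \<le> R \<Longrightarrow> p \<bullet> q - lagrangian H (x, q) \<le> a) \<Longrightarrow> H x p \<le> a"
proof -
  obtain m where m: "\<And>x p. x \<in> X \<Longrightarrow> m \<le> H x p" using bounded_below[OF X] by blast
  obtain r where r: "r > 0" "\<And>x p. x \<in> X \<Longrightarrow> norm p \<ge> r \<Longrightarrow> H x 0 + 1 * norm p \<le> H x p"
    using uniformly_superlinear[OF X] by metis
  \<comment> \<open>Chosen so that \<open>H x\<close> exceeds \<open>A\<close> on the sphere of radius \<open>M\<close>.\<close>
  define M where "M = max r (A - m + 1)"
  have M: "M > 0" using r(1) by (simp add: M_def)
  have large: "A < H x p" if "x \<in> X" "norm p = M" for x p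
    using r(2)[OF that(1), of p] m[OF that(1), of 0] that(2) by (simp add: M_def max_def split: if_splits)
  obtain B where B: "\<And>x p. x \<in> X \<Longrightarrow> norm p \<le> M + 1 \<Longrightarrow> \<bar>H x p\<bar> \<le> B"
    using bounded_on_compact[OF X] by metis
  have sub: "\<exists>q. norm q \<le> max 1 (2 * B) \<and> (\<forall>p'. H x p + q \<bullet> (p' - p) \<le> H x p')"
    if x: "x \<in> X" and p: "norm p \<le> M" for x p
  proof -
    obtain q where q: "\<And>p'. H x p + q \<bullet> (p' - p) \<le> H x p'"
      using convex_on_subgradient[OF convex] by blast
    have "norm q \<le> 2 * B" if "q \<noteq> 0"
    proof -
      have "q \<bullet> (sgn q) = norm q" using that
        by (simp add: sgn_div_norm dot_square_norm power2_eq_square)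
      moreover have "norm (p + sgn q) \<le> M + 1"
        using norm_triangle_ineq[of p "sgn q"] p that by (simp add: norm_sgn)
      ultimately show ?thesis
        using q[of "p + sgn q"] B[OF x, of p] B[OF x, of "p + sgn q"] p by simp
    qed
    then have "norm q \<le> max 1 (2 * B)" by (cases "q = 0") auto
    with q show ?thesis by blast
  qed
  show thesis
  proof (rule that[of "max 1 (2 * B)"])
    fix x p :: "real^'n" and a
    assume x: "x \<in> X" and a: "a \<le> A"
      and le: "\<And>q. norm q \<le> max 1 (2 * B) \<Longrightarrow> p \<bullet> q - lagrangian H (x, q) \<le> a"
    have eq: "H x p0 \<le> p0 \<bullet> q - lagrangian H (x, q)" if "\<forall>p'. H x p0 + q \<bullet> (p' - p0) \<le> H x p'" for p0 q
      using lagrangian_le[of q x "p0 \<bullet> q - H x p0"] that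
      by (simp add: inner_diff_right inner_commute algebra_simps)
    show "H x p \<le> a"
    proof (cases "norm p \<le> M")
      case True
      then obtain q where q: "norm q \<le> max 1 (2 * B)" "\<forall>p'. H x p + q \<bullet> (p' - p) \<le> H x p'"
        using sub[OF x] by blast
      show ?thesis using le[OF q(1)] eq[OF q(2)] by linarith
    next
      case False
      define s where "s = M / norm p"
      have np: "0 < norm p" using M False by linarith
      have s: "0 < s" "s < 1" "norm (s *\<^sub>R p) = M"
        using M False np by (simp_all add: s_def divide_less_eq_1_pos)
      obtain q where q: "norm q \<le> max 1 (2 * B)" "\<forall>p'. H x (s *\<^sub>R p) + q \<bullet> (p' - s *\<^sub>R p) \<le> H x p'"
        using sub[OF x eq_refl[OF s(3)]] by blast
      have big: "A < H x (s *\<^sub>R p)" by (rule large[OF x s(3)])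
      have "H x (s *\<^sub>R p) - s * (p \<bullet> q) \<le> H x 0"
        using q(2)[rule_format, of 0] by (simp add: inner_commute)
      then have "0 < s * (p \<bullet> q)" using big A[OF x] by linarith
      then have "0 < p \<bullet> q" using s by (simp add: zero_less_mult_iff)
      then have "s * (p \<bullet> q) \<le> p \<bullet> q" using s by (intro mult_left_le_one_le) auto
      moreover have "(s *\<^sub>R p) \<bullet> q = s * (p \<bullet> q)" by simp
      ultimately show ?thesis
        using eq[OF q(2)] le[OF q(1)] big a by linarith
    qed
  qed auto
qed

end

section \<open>Viscosity subsolutions\<close>

lemma GDERIV_local_max_eq:
  fixes f :: "'a::euclidean_space \<Rightarrow> real"
  assumes f: "GDERIV f x :> a" and \<phi>: "GDERIV \<phi> x :> b"
    and max: "\<forall>\<^sub>F y in nhds x. f y - \<phi> y \<le> f x - \<phi> x"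
  shows "a = b"
proof -
  obtain S where S: "open S" "x \<in> S" "\<And>y. y \<in> S \<Longrightarrow> f y - \<phi> y \<le> f x - \<phi> x"
    using max by (auto simp: eventually_nhds)
  have "((\<lambda>y. f y - \<phi> y) has_derivative (\<lambda>h. h \<bullet> (a - b))) (at x)"
    using GDERIV_diff[OF f \<phi>] by (simp add: gderiv_def)
  then have "(\<lambda>h. h \<bullet> (a - b)) = (\<lambda>h. 0)"
    using differential_zero_maxmin[OF S(2,1)] S(3) by blast
  then have "(a - b) \<bullet> (a - b) = 0" by meson
  then show ?thesis by simp
qed

lemma GDERIV_quadratic:
  fixes z :: "'a::euclidean_space"
  shows "GDERIV (\<lambda>y. k * (norm (y - z))\<^sup>2) y :> (2 * k) *\<^sub>R (y - z)"
  unfolding gderiv_def power2_norm_eq_inner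
  by (rule derivative_eq_intros refl)+ (auto simp: algebra_simps inner_commute)

lemma viscosity_subsolutionD:
  assumes "viscosity_subsolution \<Omega> F u"
    and "\<And>y. y \<in> \<Omega> \<Longrightarrow> GDERIV \<phi> y :> g y" "continuous_on \<Omega> g"
    and "x \<in> \<Omega>" "\<forall>\<^sub>F y in nhds x. u y - \<phi> y \<le> u x - \<phi> x"
  shows "F x (u x) (g x) \<le> 0"
  using assms unfolding viscosity_subsolution_def by blast

text \<open>
  Subtracting a steep paraboloid centred at \<open>z\<close> produces a maximum point \<open>x\<close> with \<open>u x \<ge> u z\<close>, at which the
  equation bounds \<open>u\<close> from above.
\<close>

lemma viscosity_subsolution_upper_bound:
  assumes \<Omega>: "open \<Omega>" "z \<in> \<Omega>" and l: "l > 0"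
    and sub: "viscosity_subsolution \<Omega> (\<lambda>x r p. l * r + H x p) u"
    and m: "\<And>x p. x \<in> \<Omega> \<Longrightarrow> m \<le> H x p"
  shows "u z \<le> - m / l"
proof -
  obtain s where s: "s > 0" "cball z s \<subseteq> \<Omega>" using \<Omega> open_contains_cball by blast
  have cont: "continuous_on (cball z s) u"
    using sub s(2) unfolding viscosity_subsolution_def by (meson continuous_on_subset)
  obtain w where w: "w \<in> cball z s" "\<And>y. y \<in> cball z s \<Longrightarrow> u y \<le> u w"
    using continuous_attains_sup[OF compact_cball _ cont] s(1) by auto
  \<comment> \<open>Steep enough to keep the maximum off the sphere of radius \<open>s\<close>.\<close>
  define k where "k = (u w - u z + 1) / s\<^sup>2"
  have "u z \<le> u w" using w s(1) by simp
  then have k: "k > 0" "k * s\<^sup>2 = u w - u z + 1" using s(1) by (auto simp: k_def)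
  define f where "f y = u y - k * (norm (y - z))\<^sup>2" for y
  have "continuous_on (cball z s) f" unfolding f_def by (intro continuous_intros cont)
  then obtain x where x: "x \<in> cball z s" "\<And>y. y \<in> cball z s \<Longrightarrow> f y \<le> f x"
    using continuous_attains_sup[OF compact_cball, of z s f] s(1) by auto
  have fz: "u z \<le> f x" using x(2)[of z] s(1) by (simp add: f_def)
  have "norm (x - z) \<noteq> s"
  proof
    assume "norm (x - z) = s"
    then have "f x = u x - k * s\<^sup>2" by (simp add: f_def)
    with w(2)[OF x(1)] k(2) fz show False by linarith
  qed
  then have xb: "x \<in> ball z s" using x(1) by (simp add: dist_norm norm_minus_commute)
  have "l * u x + H x ((2 * k) *\<^sub>R (x - z)) \<le> 0"
  proof (rule viscosity_subsolutionD[OF sub, of "\<lambda>y. k * (norm (y - z))\<^sup>2" "\<lambda>y. (2 * k) *\<^sub>R (y - z)" x])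
    show "\<forall>\<^sub>F y in nhds x. u y - k * (norm (y - z))\<^sup>2 \<le> u x - k * (norm (x - z))\<^sup>2"
      using eventually_nhds_in_open[OF open_ball xb]
      by eventually_elim (use x(2) in \<open>auto simp: f_def\<close>)
  qed (use x s GDERIV_quadratic in \<open>auto intro!: continuous_intros\<close>)
  moreover have "m \<le> H x ((2 * k) *\<^sub>R (x - z))" using m x(1) s(2) by blast
  moreover have "u z \<le> u x"
    using fz k(1) zero_le_power2[of "norm (x - z)"] unfolding f_def
    by (smt (verit) mult_nonneg_nonneg)
  then have "l * u z \<le> l * u x" using l by simp
  ultimately have "l * u z \<le> - m" by linarith
  then show ?thesis using l by (simp add: field_simps)
qed

text \<open>
  A test function touching the maximum from above also touches whichever of the two functions attains
  it, and a differentiable function is touched with its own gradient.  Truncation from below thus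
  confines the equation for \<open>v\<close> to the points where \<open>v\<close> is not too negative.
\<close>

lemma viscosity_subsolution_max_const:
  fixes v :: "real^'n \<Rightarrow> real"
  assumes v: "\<And>x. x \<in> \<Omega> \<Longrightarrow> GDERIV v x :> Dv x"
    and sub: "\<And>x. x \<in> \<Omega> \<Longrightarrow> c \<le> v x \<Longrightarrow> F x (v x) (Dv x) \<le> 0"
    and const: "\<And>x. x \<in> \<Omega> \<Longrightarrow> F x c 0 \<le> 0"
  shows "viscosity_subsolution \<Omega> F (\<lambda>x. max (v x) c)"
  unfolding viscosity_subsolution_def
proof (intro conjI allI impI ballI)
  have "continuous_on \<Omega> v"
    using v unfolding gderiv_def
    by (meson continuous_at_imp_continuous_on has_derivative_continuous)
  then show "continuous_on \<Omega> (\<lambda>x. max (v x) c)" by (intro continuous_intros)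
next
  fix \<phi> g x
  assume \<phi>: "(\<forall>y\<in>\<Omega>. GDERIV \<phi> y :> g y) \<and> continuous_on \<Omega> g" and x: "x \<in> \<Omega>"
    and max: "\<forall>\<^sub>F y in nhds x. max (v y) c - \<phi> y \<le> max (v x) c - \<phi> x"
  have \<phi>x: "GDERIV \<phi> x :> g x" using \<phi> x by blast
  show "F x (max (v x) c) (g x) \<le> 0"
  proof (cases "c \<le> v x")
    case True
    have "\<forall>\<^sub>F y in nhds x. v y - \<phi> y \<le> v x - \<phi> x"
      using max by eventually_elim (use True in auto)
    then have "g x = Dv x" using GDERIV_local_max_eq[OF v[OF x] \<phi>x] by simp
    then show ?thesis using sub[OF x True] True by (simp add: max_absorb1)
  next
    case False
    have "\<forall>\<^sub>F y in nhds x. c - \<phi> y \<le> c - \<phi> x"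
      using max by eventually_elim (use False in auto)
    then have "g x = 0" using GDERIV_local_max_eq[OF GDERIV_const \<phi>x] by simp
    then show ?thesis using const[OF x] False by (simp add: max_absorb2)
  qed
qed

text \<open>
  The viscosity form of integrating \<open>Du \<bullet> q < m\<close> along a segment.  The auxiliary function
  \<open>\<Psi> (y, s) = u y - k * \<bar>y - x0 - s q\<bar>\<^sup>2 - m * s\<close> cannot have its maximum at a time \<open>s > 0\<close>: the \<open>y\<close> variable
  would give a test function whose gradient \<open>g\<close> satisfies \<open>g \<bullet> q < m\<close>, while maximality in \<open>s\<close>, even from
  one side only, gives \<open>g \<bullet> q \<ge> m\<close>.  So \<open>\<Psi>\<close> at the end of the segment is at most its maximum at
  \<open>s = 0\<close>, which the penalty forces close to \<open>u x0\<close>.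
\<close>

lemma viscosity_subsolution_increment:
  fixes u :: "real^'n \<Rightarrow> real"
  assumes sub: "viscosity_subsolution UNIV F u"
    and slope: "\<And>y g. y \<in> cball x0 \<delta> \<Longrightarrow> F y (u y) g \<le> 0 \<Longrightarrow> g \<bullet> q < m"
    and \<delta>: "\<delta> > 0" and T: "T > 0" "T * norm q \<le> \<delta> / 2"
  shows "u (x0 + T *\<^sub>R q) \<le> u x0 + m * T"
proof (rule field_le_epsilon)
  fix e :: real assume e: "e > 0"
  have cu: "continuous_on S u" for S
    using sub unfolding viscosity_subsolution_def by (meson continuous_on_subset top_greatest)
  obtain \<delta>' where \<delta>': "\<delta>' > 0" "\<And>y. norm (y - x0) < \<delta>' \<Longrightarrow> u y \<le> u x0 + e"
    using cu[of UNIV] e unfolding continuous_on_iff dist_norm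
    by (metis UNIV_I abs_le_D1 diff_le_eq less_imp_le real_norm_def add.commute)
  have "bounded (u ` cball x0 \<delta>)" by (intro compact_imp_bounded compact_continuous_image cu compact_cball)
  then obtain M where M: "\<And>y. y \<in> cball x0 \<delta> \<Longrightarrow> \<bar>u y\<bar> \<le> M"
    unfolding bounded_iff by (metis imageI real_norm_def)
  define \<rho> where "\<rho> = min \<delta>' (\<delta> / 2)"
  have \<rho>: "\<rho> > 0" using \<delta> \<delta>' by (simp add: \<rho>_def)
  \<comment> \<open>Leaving the \<open>\<rho>\<close>-neighbourhood of the segment costs more than the oscillation \<open>2 * M\<close> of \<open>u\<close>.\<close>
  define k where "k = (2 * M + 1) / \<rho>\<^sup>2"
  have "M \<ge> 0" using M[of x0] \<delta> by simp
  then have k: "k > 0" "k * \<rho>\<^sup>2 = 2 * M + 1" using \<rho> by (auto simp: k_def)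
  define \<Psi> where "\<Psi> w = u (fst w) - k * (norm (fst w - x0 - snd w *\<^sub>R q))\<^sup>2 - m * snd w" for w
  have seg: "x0 + s *\<^sub>R q \<in> cball x0 \<delta>" if "s \<in> {0..T}" for s
  proof -
    have "s * norm q \<le> T * norm q" using that by (intro mult_right_mono) auto
    then show ?thesis using T \<delta> that by (simp add: dist_norm)
  qed
  have "continuous_on (cball x0 \<delta> \<times> {0..T}) \<Psi>" unfolding \<Psi>_def
    by (intro continuous_intros continuous_on_compose2[OF cu[of UNIV]]) auto
  moreover have "compact (cball x0 \<delta> \<times> {0..T})" by (intro compact_Times compact_cball compact_Icc)
  moreover have "cball x0 \<delta> \<times> {0..T} \<noteq> {}" using \<delta> T by auto
  ultimately obtain w where w: "w \<in> cball x0 \<delta> \<times> {0..T}" "\<And>w'. w' \<in> cball x0 \<delta> \<times> {0..T} \<Longrightarrow> \<Psi> w' \<le> \<Psi> w"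
    using continuous_attains_sup by metis
  obtain y s where ys: "w = (y, s)" by (cases w)
  have y: "y \<in> cball x0 \<delta>" and s: "s \<in> {0..T}" using w(1) by (auto simp: ys)
  define d where "d = y - x0 - s *\<^sub>R q"
  have "\<Psi> (x0 + s *\<^sub>R q, s) \<le> \<Psi> (y, s)" using w(2) seg[OF s] s by (auto simp: ys)
  then have "u (x0 + s *\<^sub>R q) \<le> u y - k * (norm d)\<^sup>2" by (simp add: \<Psi>_def d_def)
  then have "k * (norm d)\<^sup>2 < k * \<rho>\<^sup>2" using M[OF y] M[OF seg[OF s]] k(2) by linarith
  then have d: "norm d < \<rho>" using k(1) \<rho> by (metis less_imp_le mult_less_cancel_left_pos power_less_imp_less_base)
  have "s = 0"
  proof (rule ccontr)
    assume "s \<noteq> 0"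
    then have s0: "s > 0" using s by simp
    have "s * norm q \<le> \<delta> / 2" using T s mult_right_mono[of s T "norm q"] by auto
    moreover have "y - x0 = d + s *\<^sub>R q" by (simp add: d_def)
    ultimately have "norm (y - x0) < \<delta>"
      using norm_triangle_ineq[of d "s *\<^sub>R q"] d s0 by (simp add: \<rho>_def)
    then have yb: "y \<in> ball x0 \<delta>" by (simp add: dist_norm norm_minus_commute)
    have "F y (u y) ((2 * k) *\<^sub>R (y - (x0 + s *\<^sub>R q))) \<le> 0"
    proof (rule viscosity_subsolutionD[OF sub, of "\<lambda>y. k * (norm (y - (x0 + s *\<^sub>R q)))\<^sup>2" "\<lambda>y. (2 * k) *\<^sub>R (y - (x0 + s *\<^sub>R q))" y])
      show "\<forall>\<^sub>F y' in nhds y. u y' - k * (norm (y' - (x0 + s *\<^sub>R q)))\<^sup>2 \<le> u y - k * (norm (y - (x0 + s *\<^sub>R q)))\<^sup>2"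
        using eventually_nhds_in_open[OF open_ball yb]
      proof eventually_elim
        case (elim y')
        then have "\<Psi> (y', s) \<le> \<Psi> (y, s)" using w(2)[of "(y', s)"] s by (simp add: ys)
        then show ?case by (simp add: \<Psi>_def diff_diff_eq)
      qed
    qed (auto intro!: continuous_intros GDERIV_quadratic)
    then have "F y (u y) ((2 * k) *\<^sub>R d) \<le> 0" by (simp only: d_def diff_diff_eq)
    from slope[OF y this] have neg: "2 * k * (d \<bullet> q) - m < 0" by simp
    define \<theta> where "\<theta> t = - k * ((y - x0 - t *\<^sub>R q) \<bullet> (y - x0 - t *\<^sub>R q)) - m * t" for t
    have "(\<theta> has_real_derivative 2 * k * (d \<bullet> q) - m) (at s)"
      unfolding \<theta>_def has_field_derivative_def
      by (rule derivative_eq_intros refl)+ (auto simp: d_def algebra_simps inner_commute)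
    from DERIV_neg_dec_left[OF this neg] obtain d' where d': "d' > 0" "\<And>h. 0 < h \<Longrightarrow> h < d' \<Longrightarrow> \<theta> s < \<theta> (s - h)"
      by blast
    define h where "h = min (d' / 2) s"
    have h: "0 < h" "h < d'" "h \<le> s" using d' s0 by (auto simp: h_def)
    have "\<Psi> (y, s - h) \<le> \<Psi> (y, s)" using w(2)[of "(y, s - h)"] y s h by (simp add: ys)
    then have "\<theta> (s - h) \<le> \<theta> s" by (simp add: \<Psi>_def \<theta>_def power2_norm_eq_inner)
    then show False using d'(2)[OF h(1,2)] by simp
  qed
  have "\<Psi> (x0 + T *\<^sub>R q, T) \<le> \<Psi> (y, s)" using w(2)[of "(x0 + T *\<^sub>R q, T)"] seg[of T] T by (simp add: ys)
  then have "u (x0 + T *\<^sub>R q) - m * T \<le> u y - k * (norm d)\<^sup>2" by (simp add: \<Psi>_def d_def \<open>s = 0\<close>)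
  also have "\<dots> \<le> u y" using k(1) by simp
  also have "\<dots> \<le> u x0 + e" using d by (intro \<delta>'(2)) (simp add: d_def \<open>s = 0\<close> \<rho>_def)
  finally show "u (x0 + T *\<^sub>R q) \<le> u x0 + m * T + e" by simp
qed

section \<open>Subsolutions in the weak sense\<close>

lemma integrable_continuous_compact_support:
  fixes f :: "'a::euclidean_space \<Rightarrow> real"
  assumes "continuous_on UNIV f" "\<And>y. norm y > B \<Longrightarrow> f y = 0"
  shows "integrable lborel f"
proof -
  have "integrable lborel (\<lambda>x. indicator (cball 0 B) x *\<^sub>R f x)"
    by (intro borel_integrable_compact compact_cball continuous_on_subset[OF assms(1)]) auto
  moreover have "(\<lambda>x. indicator (cball 0 B) x *\<^sub>R f x) = f"
    using assms(2) by (force simp: indicator_def)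
  ultimately show ?thesis by simp
qed

text \<open>
  The inequality \<open>l * u + Du \<bullet> q \<le> \<Phi>(x, q)\<close> tested against nonnegative kernels, with the directional
  derivative replaced by difference quotients: it makes sense for continuous \<open>u\<close>, follows from both
  notions of subsolution, and is exactly what convolution with a kernel can see.
\<close>

definition weak_subsolution ::
  "real \<Rightarrow> ((real^'n) \<times> (real^'n) \<Rightarrow> real) \<Rightarrow> (real^'n \<Rightarrow> real) \<Rightarrow> bool" where
  "weak_subsolution l \<Phi> u \<longleftrightarrow> continuous_on UNIV u \<and>
    (\<forall>q k B \<delta>. continuous_on UNIV k \<and> (\<forall>y. 0 \<le> k y) \<and> (\<forall>y. norm y > B \<longrightarrow> k y = 0) \<and> \<delta> > 0 \<longrightarrow>
      (\<forall>\<^sub>F n in sequentially.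
        real n * (\<integral>y. k y * (u (y + (1 / real n) *\<^sub>R q) - u y) \<partial>lborel)
          \<le> (\<integral>y. k y * (\<Phi> (y, q) - l * u y) \<partial>lborel) + \<delta>))"

text \<open>
  Fenchel's inequality turns the nonlinear equation into a bound on the slope of \<open>u\<close> in each fixed
  direction \<open>q\<close>, which the increment estimate makes uniform over the support of the kernel.
\<close>

lemma viscosity_imp_weak_subsolution:
  assumes "superlinear_hamiltonian H"
    and sub: "viscosity_subsolution UNIV (\<lambda>x r p. l * r + H x p) u"
  shows "weak_subsolution l (lagrangian H) u"
  unfolding weak_subsolution_def
proof (intro conjI allI impI)
  interpret superlinear_hamiltonian H by fact
  show cu: "continuous_on UNIV u" using sub by (simp add: viscosity_subsolution_def)
  fix q :: "real^'a" and k :: "real^'a \<Rightarrow> real" and B \<delta> :: real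
  assume "continuous_on UNIV k \<and> (\<forall>y. 0 \<le> k y) \<and> (\<forall>y. norm y > B \<longrightarrow> k y = 0) \<and> \<delta> > 0"
  then have k: "continuous_on UNIV k" "\<And>y. 0 \<le> k y" "\<And>y. norm y > B \<Longrightarrow> k y = 0" and \<delta>: "\<delta> > 0" by auto
  define f where "f y = lagrangian H (y, q) - l * u y" for y
  have cf: "continuous_on UNIV f" unfolding f_def
    by (intro continuous_intros cu continuous_on_compose2[OF continuous_lagrangian]) auto
  define I where "I = (\<integral>y. k y \<partial>lborel)"
  have I: "I \<ge> 0" unfolding I_def by (rule integral_nonneg_AE) (use k in auto)
  have ik: "integrable lborel k" by (rule integrable_continuous_compact_support[OF k(1,3)])
  define \<eta> where "\<eta> = \<delta> / (I + 1)"
  have \<eta>: "\<eta> > 0" "\<eta> * I \<le> \<delta>" using \<delta> I by (auto simp: \<eta>_def field_simps)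
  have uc: "uniformly_continuous_on (cball 0 (B + 1)) f"
    by (intro compact_uniformly_continuous compact_cball continuous_on_subset[OF cf]) auto
  obtain d where d: "d > 0" "\<And>x y. x \<in> cball 0 (B + 1) \<Longrightarrow> y \<in> cball 0 (B + 1) \<Longrightarrow> dist y x < d \<Longrightarrow> dist (f y) (f x) < \<eta>"
    by (rule uniformly_continuous_onE[OF uc \<eta>(1)]) (rule that)
  define r where "r = min (d / 2) 1"
  have r: "r > 0" "r < d" "r \<le> 1" using d by (auto simp: r_def)
  have step: "u (x + T *\<^sub>R q) \<le> u x + (f x + \<eta>) * T" if x: "norm x \<le> B" and T: "T > 0" "T * norm q \<le> r / 2" for x T
  proof (rule viscosity_subsolution_increment[OF sub _ r(1) T])
    fix y g assume y: "y \<in> cball x r" and le: "l * u y + H y g \<le> 0"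
    have "norm y \<le> B + 1" using y x r norm_triangle_sub[of y x] by (auto simp: dist_norm norm_minus_commute)
    then have "dist (f y) (f x) < \<eta>" using y x r by (intro d(2)) (auto simp: dist_commute)
    then have "f y < f x + \<eta>" unfolding dist_real_def by linarith
    moreover have "g \<bullet> q \<le> f y" using fenchel_inequality[of g q y] le unfolding f_def by linarith
    ultimately show "g \<bullet> q < f x + \<eta>" by simp
  qed
  obtain N :: nat where N: "N > 0" "norm q / real N \<le> r / 2"
  proof -
    obtain N0 :: nat where "norm q / (r / 2) < real N0" using reals_Archimedean2 by blast
    then have "norm q / (r / 2) < real (Suc N0)" by simp
    then have "norm q < real (Suc N0) * (r / 2)" using r(1) by (simp only: pos_divide_less_eq)
    then have "norm q / real (Suc N0) < r / 2" by (subst pos_divide_less_eq) (auto simp: mult.commute)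
    then show thesis by (intro that[of "Suc N0"]) auto
  qed
  show "\<forall>\<^sub>F n in sequentially. real n * (\<integral>y. k y * (u (y + (1 / real n) *\<^sub>R q) - u y) \<partial>lborel)
          \<le> (\<integral>y. k y * (lagrangian H (y, q) - l * u y) \<partial>lborel) + \<delta>"
    using eventually_ge_at_top[of N]
  proof eventually_elim
    case (elim n)
    have n: "real n > 0" using elim N by auto
    have "norm q / real n \<le> norm q / real N" using elim N by (intro divide_left_mono) auto
    also note N(2)
    finally have T: "1 / real n * norm q \<le> r / 2" by simp
    have pt: "real n * (k y * (u (y + (1 / real n) *\<^sub>R q) - u y)) \<le> k y * f y + \<eta> * k y" for y
    proof (cases "norm y \<le> B")
      case True
      have "u (y + (1 / real n) *\<^sub>R q) - u y \<le> (f y + \<eta>) * (1 / real n)"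
        using step[OF True _ T] n by simp
      then have "real n * (u (y + (1 / real n) *\<^sub>R q) - u y) \<le> f y + \<eta>" using n by (simp add: field_simps)
      from mult_left_mono[OF this k(2)[of y]] show ?thesis by (simp add: algebra_simps)
    qed (use k(3) in auto)
    have int1: "integrable lborel (\<lambda>y. k y * (u (y + (1 / real n) *\<^sub>R q) - u y))"
      by (rule integrable_continuous_compact_support[of _ B])
         (use k in \<open>auto intro!: continuous_intros continuous_on_compose2[OF cu]\<close>)
    have int2: "integrable lborel (\<lambda>y. k y * f y)"
      by (rule integrable_continuous_compact_support[of _ B]) (use k in \<open>auto intro!: continuous_intros cf\<close>)
    have "(\<integral>y. real n * (k y * (u (y + (1 / real n) *\<^sub>R q) - u y)) \<partial>lborel) \<le> (\<integral>y. k y * f y + \<eta> * k y \<partial>lborel)"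
      using int1 int2 ik pt by (intro integral_mono) auto
    also have "\<dots> = (\<integral>y. k y * f y \<partial>lborel) + \<eta> * I"
      using int2 ik by (simp add: I_def)
    finally show ?case using \<eta>(2) by (simp add: f_def)
  qed
qed

lemma GDERIV_difference_quotient:
  fixes u :: "'a::euclidean_space \<Rightarrow> real"
  assumes "GDERIV u x :> d"
  shows "(\<lambda>n. real n * (u (x + (1 / real n) *\<^sub>R q) - u x)) \<longlonglongrightarrow> d \<bullet> q"
proof -
  have 1: "((\<lambda>t. x + t *\<^sub>R q) has_derivative (\<lambda>t. t *\<^sub>R q)) (at 0)"
    by (auto intro!: derivative_eq_intros)
  have "(u has_derivative (\<lambda>h. h \<bullet> d)) (at (x + 0 *\<^sub>R q))"
    using assms by (simp add: gderiv_def)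
  from has_derivative_compose[OF 1 this]
  have "((\<lambda>t. u (x + t *\<^sub>R q)) has_real_derivative (d \<bullet> q)) (at 0)"
    by (simp add: has_field_derivative_def mult_commute_abs inner_commute)
  then have "((\<lambda>t. (u (x + t *\<^sub>R q) - u x) / t) \<longlongrightarrow> d \<bullet> q) (at 0)"
    by (simp add: has_field_derivative_iff)
  moreover have "filterlim (\<lambda>n. 1 / real n) (at 0) sequentially"
    unfolding filterlim_at using lim_inverse_n'
    by (auto intro!: eventually_sequentiallyI[of 1])
  ultimately have "(\<lambda>n. (u (x + (1 / real n) *\<^sub>R q) - u x) / (1 / real n)) \<longlonglongrightarrow> d \<bullet> q"
    by (rule filterlim_compose)
  then show ?thesis by (simp add: mult.commute)
qed

text \<open>
  The positive part of the defect in the inequality for difference quotients tends to 0 almost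
  everywhere and is bounded thanks to the local Lipschitz property.  Working with the positive part
  gives dominated convergence the limit 0, whereas the limit of the difference quotients themselves is
  a gradient whose measurability is a question of its own.
\<close>

lemma discounted_imp_weak_subsolution:
  fixes u :: "real^'n \<Rightarrow> real"
  assumes c\<Phi>: "continuous_on UNIV \<Phi>" and sub: "discounted_subsolution l \<Phi> u"
  shows "weak_subsolution l \<Phi> u"
  unfolding weak_subsolution_def
proof (intro conjI allI impI)
  have lip: "\<forall>x. \<exists>r>0. \<exists>K. K-lipschitz_on (ball x r) u"
    and ae: "AE x in lborel. \<exists>d. GDERIV u x :> d \<and> (\<forall>q. l * u x + d \<bullet> q \<le> \<Phi> (x, q))"
    using sub by (auto simp: discounted_subsolution_def)
  show cu: "continuous_on UNIV u"
  proof (rule continuous_at_imp_continuous_on, rule ballI)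
    fix x
    obtain r K where "r > 0" "K-lipschitz_on (ball x r) u" using lip by blast
    then show "isCont u x"
      using continuous_on_interior[OF lipschitz_on_continuous_on, of K "ball x r" u x] by simp
  qed
  fix q :: "real^'n" and k :: "real^'n \<Rightarrow> real" and B \<delta> :: real
  assume "continuous_on UNIV k \<and> (\<forall>y. 0 \<le> k y) \<and> (\<forall>y. norm y > B \<longrightarrow> k y = 0) \<and> \<delta> > 0"
  then have k: "continuous_on UNIV k" "\<And>y. 0 \<le> k y" "\<And>y. norm y > B \<Longrightarrow> k y = 0" and \<delta>: "\<delta> > 0" by auto
  define X where "X = cball (0::real^'n) (B + norm q)"
  have "local_lipschitz {0::real} UNIV (\<lambda>_. u)"
  proof (rule local_lipschitzI)
    fix t :: real and x :: "real^'n"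
    obtain r K where r: "r > 0" "K-lipschitz_on (ball x r) u" using lip by blast
    have "K-lipschitz_on (cball x (r / 2) \<inter> UNIV) u"
      using r(1) by (intro lipschitz_on_subset[OF r(2)]) auto
    then show "\<exists>v>0. \<exists>L. \<forall>t\<in>cball t v \<inter> {0}. L-lipschitz_on (cball x v \<inter> UNIV) u"
      using r(1) by (intro exI[of _ "r / 2"]) auto
  qed
  then have "local_lipschitz {0::real} X (\<lambda>_. u)"
    by (rule local_lipschitz_subset) auto
  then obtain K where K: "K-lipschitz_on X u"
    using local_lipschitz_compact_implies_lipschitz[where X = X and T = "{0::real}" and f = "\<lambda>_. u"]
    by (auto simp: X_def)
  define f where "f y = \<Phi> (y, q) - l * u y" for y
  have cf: "continuous_on UNIV f" unfolding f_def
    by (intro continuous_intros cu continuous_on_compose2[OF c\<Phi>]) auto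
  have "bounded (f ` cball 0 B)"
    by (intro compact_imp_bounded compact_continuous_image compact_cball continuous_on_subset[OF cf]) auto
  then obtain C where C: "\<And>y. norm y \<le> B \<Longrightarrow> \<bar>f y\<bar> \<le> C"
    unfolding bounded_iff by (metis imageI mem_cball_0 real_norm_def)
  define D where "D n y = real n * (u (y + (1 / real n) *\<^sub>R q) - u y)" for n y
  define E where "E n y = k y * max 0 (D n y - f y)" for n y
  have cD: "continuous_on UNIV (D n)" for n unfolding D_def
    by (intro continuous_intros cu continuous_on_compose2[OF cu]) auto
  have cE: "continuous_on UNIV (E n)" for n unfolding E_def
    by (intro continuous_intros k(1) cD cf)
  have D_bound: "\<bar>D n y\<bar> \<le> K * norm q" if y: "norm y \<le> B" for n y
  proof (cases "n = 0")
    case True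
    then show ?thesis using lipschitz_on_nonneg[OF K] by (simp add: D_def)
  next
    case False
    have "(1 / real n) * norm q \<le> 1 * norm q" using False by (intro mult_right_mono) auto
    then have "norm (y + (1 / real n) *\<^sub>R q) \<le> B + norm q"
      using norm_triangle_ineq[of y "(1 / real n) *\<^sub>R q"] y by simp
    moreover have "norm y \<le> B + norm q" using y by (simp add: add_increasing2)
    ultimately have "dist (u (y + (1 / real n) *\<^sub>R q)) (u y) \<le> K * dist (y + (1 / real n) *\<^sub>R q) y"
      by (intro lipschitz_onD[OF K]) (auto simp: X_def)
    then have "\<bar>u (y + (1 / real n) *\<^sub>R q) - u y\<bar> \<le> K * (norm q / real n)"
      by (simp add: dist_norm)
    then have "real n * \<bar>u (y + (1 / real n) *\<^sub>R q) - u y\<bar> \<le> K * norm q" using False by (simp add: field_simps)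
    then show ?thesis by (simp only: D_def abs_mult abs_of_nat)
  qed
  have "(\<lambda>n. \<integral>y. E n y \<partial>lborel) \<longlonglongrightarrow> (\<integral>y. 0 \<partial>(lborel :: (real^'n) measure))"
  proof (rule integral_dominated_convergence[where w = "\<lambda>y. k y * (K * norm q + C)"])
    show "integrable lborel (\<lambda>y. k y * (K * norm q + C))"
      using integrable_continuous_compact_support[OF k(1,3)] by simp
    show "E n \<in> borel_measurable lborel" for n
      using borel_measurable_continuous_onI[OF cE] by simp
    show "AE y in lborel. (\<lambda>n. E n y) \<longlonglongrightarrow> 0"
      using ae
    proof eventually_elim
      case (elim y)
      then obtain d where d: "GDERIV u y :> d" "l * u y + d \<bullet> q \<le> \<Phi> (y, q)" by blast
      have "(\<lambda>n. E n y) \<longlonglongrightarrow> k y * max 0 (d \<bullet> q - f y)" unfolding E_def D_def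
        by (intro tendsto_intros GDERIV_difference_quotient[OF d(1)])
      moreover have "max 0 (d \<bullet> q - f y) = 0" using d(2) by (simp add: f_def)
      ultimately show ?case by simp
    qed
    fix n
    show "AE y in lborel. norm (E n y) \<le> k y * (K * norm q + C)"
    proof (rule AE_I2)
      fix y
      show "norm (E n y) \<le> k y * (K * norm q + C)"
      proof (cases "norm y \<le> B")
        case True
        have "\<bar>max 0 (D n y - f y)\<bar> \<le> K * norm q + C" using D_bound[OF True, of n] C[OF True] by linarith
        then show ?thesis using k(2)[of y] by (simp add: E_def abs_mult mult_left_mono)
      qed (use k(3) in \<open>auto simp: E_def\<close>)
    qed
  qed auto
  then have "\<forall>\<^sub>F n in sequentially. (\<integral>y. E n y \<partial>lborel) < \<delta>"
    using \<delta> by (auto dest: order_tendstoD(2))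
  then show "\<forall>\<^sub>F n in sequentially. real n * (\<integral>y. k y * (u (y + (1 / real n) *\<^sub>R q) - u y) \<partial>lborel)
          \<le> (\<integral>y. k y * (\<Phi> (y, q) - l * u y) \<partial>lborel) + \<delta>"
  proof eventually_elim
    case (elim n)
    have iD: "integrable lborel (\<lambda>y. k y * D n y)" and iF: "integrable lborel (\<lambda>y. k y * f y)" and iE: "integrable lborel (E n)"
      using k cD cf cE by (auto intro!: integrable_continuous_compact_support[of _ B] continuous_intros simp: E_def)
    have "(\<integral>y. k y * D n y \<partial>lborel) - (\<integral>y. k y * f y \<partial>lborel) = (\<integral>y. k y * D n y - k y * f y \<partial>lborel)"
      using iD iF by simp
    also have "\<dots> \<le> (\<integral>y. E n y \<partial>lborel)"
    proof (intro integral_mono iE Bochner_Integration.integrable_diff iD iF)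
      fix y show "k y * D n y - k y * f y \<le> E n y"
        using mult_left_mono[OF max.cobounded2[of "D n y - f y" 0] k(2)[of y]]
        by (simp add: E_def right_diff_distrib)
    qed
    also have "(\<integral>y. k y * D n y \<partial>lborel) = real n * (\<integral>y. k y * (u (y + (1 / real n) *\<^sub>R q) - u y) \<partial>lborel)"
      by (simp add: D_def flip: integral_mult_right_zero) (simp add: mult.left_commute)
    finally show ?case using elim by (simp add: f_def)
  qed
qed

section \<open>Smoothing\<close>

text \<open>
  A kernel supported by the ball of radius \<open>e\<close>, with just enough regularity (C1) for smoothing merely
  continuous functions; it is not normalized.
\<close>

definition bump :: "real \<Rightarrow> 'a::euclidean_space \<Rightarrow> real" where
  "bump e y = (max 0 (e\<^sup>2 - y \<bullet> y))\<^sup>2"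

lemma DERIV_max_0_square: "((\<lambda>t::real. (max 0 t)\<^sup>2) has_real_derivative 2 * max 0 t) (at t)"
proof -
  consider "t > 0" | "t < 0" | "t = 0" by linarith
  then show ?thesis
  proof cases
    case 1
    have "((\<lambda>t::real. t\<^sup>2) has_real_derivative 2 * max 0 t) (at t)"
      using 1 by (auto intro!: derivative_eq_intros)
    then show ?thesis
      by (rule DERIV_cong_ev[THEN iffD1, rotated -1])
         (use 1 eventually_nhds_in_open[of "{0<..}" t] in \<open>auto elim!: eventually_mono\<close>)
  next
    case 2
    have "((\<lambda>t::real. 0) has_real_derivative 2 * max 0 t) (at t)"
      using 2 by (auto intro!: derivative_eq_intros)
    then show ?thesis
      by (rule DERIV_cong_ev[THEN iffD1, rotated -1])
         (use 2 eventually_nhds_in_open[of "{..<0}" t] in \<open>auto elim!: eventually_mono\<close>)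
  next
    case 3
    have "((\<lambda>h::real. (max 0 h)\<^sup>2 / h) \<longlongrightarrow> 0) (at 0)"
    proof (rule Lim_null_comparison)
      show "\<forall>\<^sub>F h in at 0. norm ((max 0 h)\<^sup>2 / h) \<le> \<bar>h::real\<bar>"
        by (auto intro!: always_eventually simp: max_def power2_eq_square)
      show "((\<lambda>h::real. \<bar>h\<bar>) \<longlongrightarrow> 0) (at 0)" by (intro tendsto_eq_intros) auto
    qed
    then show ?thesis using 3 by (simp add: has_field_derivative_iff)
  qed
qed

lemma bump_nonneg: "0 \<le> bump e y" by (simp add: bump_def)

lemma bump_eq_0: "e \<ge> 0 \<Longrightarrow> norm y \<ge> e \<Longrightarrow> bump e y = 0"
  using power_mono[of e "norm y" 2] by (simp add: bump_def power2_norm_eq_inner)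

lemma continuous_on_bump: "continuous_on S f \<Longrightarrow> continuous_on S (\<lambda>y. bump e (f y))"
  unfolding bump_def by (intro continuous_intros)

lemma bump_translate_has_derivative:
  "((\<lambda>x. bump e (y - x)) has_derivative (\<lambda>h. h \<bullet> ((4 * max 0 (e\<^sup>2 - (y - x) \<bullet> (y - x))) *\<^sub>R (y - x)))) (at x within U)"
proof -
  have "((\<lambda>x. e\<^sup>2 - (y - x) \<bullet> (y - x)) has_derivative (\<lambda>h. 2 * (h \<bullet> (y - x)))) (at x within U)"
    by (rule derivative_eq_intros refl)+ (auto simp: inner_commute)
  from has_derivative_compose[OF this DERIV_max_0_square[unfolded has_field_derivative_def]]
  show ?thesis unfolding bump_def by (simp add: mult.assoc mult.left_commute mult.commute)
qed

lemma integral_bump_pos: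
  fixes x :: "'a::euclidean_space"
  assumes "e > 0"
  shows "0 < (\<integral>y. bump e (y - x) \<partial>lborel)"
proof -
  have int: "integrable lborel (\<lambda>y. bump e (y - x))"
  proof (rule integrable_continuous_compact_support[of _ "norm x + e"])
    show "continuous_on UNIV (\<lambda>y. bump e (y - x))" by (intro continuous_on_bump continuous_intros)
    fix y :: 'a assume "norm y > norm x + e"
    then show "bump e (y - x) = 0"
      using assms norm_triangle_sub[of y x] by (intro bump_eq_0) auto
  qed
  have "(\<integral>y. bump e (y - x) \<partial>lborel) \<noteq> 0"
  proof
    assume "(\<integral>y. bump e (y - x) \<partial>lborel) = 0"
    then have "AE y in lborel. bump e (y - x) = 0"
      using integral_nonneg_eq_0_iff_AE[OF int] bump_nonneg by auto
    then have "AE y in lborel. y \<notin> ball x e"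
    proof eventually_elim
      case (elim y)
      show ?case
      proof
        assume "y \<in> ball x e"
        then have "norm (y - x) < e" by (simp add: dist_norm norm_minus_commute)
        then have "(norm (y - x))\<^sup>2 < e\<^sup>2" by (intro power_strict_mono) auto
        with elim show False by (simp add: bump_def power2_norm_eq_inner)
      qed
    qed
    then have "ball x e \<in> null_sets lborel" by (subst AE_iff_null_sets) auto
    then have "emeasure lborel (ball x e) = 0" by auto
    then show False using assms emeasure_lborel_ball_finite[of x e] content_ball_pos[of e x]
      by (simp add: measure_def)
  qed
  moreover have "0 \<le> (\<integral>y. bump e (y - x) \<partial>lborel)" by (intro integral_nonneg_AE) (auto simp: bump_nonneg)
  ultimately show ?thesis by linarith
qed

text \<open>
  The integral is taken over a fixed box so that the smoothed function is C1 on the whole space.  Well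
  inside the box it is the convolution with the bump.
\<close>

lemma smoothing_has_gradient:
  fixes u :: "'a::euclidean_space \<Rightarrow> real" and e :: real
  assumes cu: "continuous_on UNIV u"
  defines "g x y \<equiv> (4 * max 0 (e\<^sup>2 - (y - x) \<bullet> (y - x)) * u y) *\<^sub>R (y - x)"
  shows "GDERIV (\<lambda>x. integral (cbox a b) (\<lambda>y. bump e (y - x) * u y)) x :> integral (cbox a b) (g x)"
    and "continuous_on UNIV (\<lambda>x. integral (cbox a b) (g x))"
proof -
  have cg: "continuous_on UNIV (\<lambda>w. g (fst w) (snd w))" unfolding g_def
    by (intro continuous_intros continuous_on_compose2[OF cu]) auto
  have "continuous_on (UNIV \<times> cbox a b) (\<lambda>(x, y). g x y)"
    using continuous_on_subset[OF cg] by (simp add: split_beta)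
  then show "continuous_on UNIV (\<lambda>x. integral (cbox a b) (g x))"
    by (rule integral_continuous_on_param)
  have cgx: "continuous_on (cbox a b) (g x)" for x
    unfolding g_def by (intro continuous_intros continuous_on_subset[OF cu]) auto
  have "((\<lambda>x. integral (cbox a b) (\<lambda>y. bump e (y - x) * u y)) has_derivative
      blinfun_apply (integral (cbox a b) (\<lambda>y. blinfun_inner_left (g x y)))) (at x within UNIV)"
  proof (rule leibniz_rule)
    fix x y :: 'a
    show "((\<lambda>x. bump e (y - x) * u y) has_derivative blinfun_apply (blinfun_inner_left (g x y))) (at x within UNIV)"
      by (rule has_derivative_eq_rhs[OF has_derivative_mult_left[OF bump_translate_has_derivative]])
         (auto simp: g_def mult_ac)
    show "(\<lambda>y. bump e (y - x) * u y) integrable_on cbox a b"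
      by (intro integrable_continuous continuous_intros continuous_on_bump continuous_on_subset[OF cu]) auto
  next
    show "continuous_on (UNIV \<times> cbox a b) (\<lambda>(x, y). blinfun_inner_left (g x y))"
      using continuous_on_subset[OF cg]
      by (auto simp: split_beta intro!: bounded_linear.continuous_on[OF bounded_linear_blinfun_inner_left])
  qed auto
  moreover have "integral (cbox a b) (\<lambda>y. blinfun_inner_left (g x y)) = blinfun_inner_left (integral (cbox a b) (g x))"
    using integral_linear[OF integrable_continuous[OF cgx] bounded_linear_blinfun_inner_left]
    by (simp add: o_def)
  ultimately show "GDERIV (\<lambda>x. integral (cbox a b) (\<lambda>y. bump e (y - x) * u y)) x :> integral (cbox a b) (g x)"
    by (simp add: gderiv_def)
qed

text \<open>
  At a point \<open>x\<close>, the difference quotients of the convolution are those of \<open>u\<close> integrated against the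
  bump centred at \<open>x\<close>, by translation invariance.  The weak inequality therefore bounds the directional
  derivatives of the convolution by the average of \<open>\<Phi>(_, q) - l * u\<close> near \<open>x\<close>, and uniform continuity
  replaces the average of \<open>\<Phi>(_, q)\<close> by its value at \<open>x\<close>.
\<close>

lemma weak_subsolution_smoothing:
  fixes u :: "real^'n \<Rightarrow> real"
  assumes c\<Phi>: "continuous_on UNIV \<Phi>" and weak: "weak_subsolution l \<Phi> u" and \<delta>: "\<delta> > 0"
  obtains v Dv where "\<And>x. GDERIV v x :> Dv x" "continuous_on UNIV Dv"
    "\<And>x q. norm x \<le> S \<Longrightarrow> norm q \<le> R \<Longrightarrow> l * v x + Dv x \<bullet> q \<le> \<Phi> (x, q) + \<delta>"
    "\<And>x. norm x \<le> S \<Longrightarrow> \<bar>v x - u x\<bar> \<le> \<delta>"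
proof -
  have cu: "continuous_on UNIV u" using weak by (simp add: weak_subsolution_def)
  have uc1: "uniformly_continuous_on (cball 0 (S + 1)) u"
    by (intro compact_uniformly_continuous compact_cball continuous_on_subset[OF cu]) auto
  obtain d1 where d1: "d1 > 0"
    "\<And>x y. x \<in> cball 0 (S + 1) \<Longrightarrow> y \<in> cball 0 (S + 1) \<Longrightarrow> dist y x < d1 \<Longrightarrow> dist (u y) (u x) < \<delta>"
    by (rule uniformly_continuous_onE[OF uc1 \<delta>]) (rule that)
  have uc2: "uniformly_continuous_on (cball 0 (S + 1) \<times> cball 0 R) \<Phi>"
    by (intro compact_uniformly_continuous compact_Times compact_cball continuous_on_subset[OF c\<Phi>]) auto
  obtain d2 where d2: "d2 > 0"
    "\<And>x y. x \<in> cball 0 (S + 1) \<times> cball 0 R \<Longrightarrow> y \<in> cball 0 (S + 1) \<times> cball 0 R \<Longrightarrow>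
       dist y x < d2 \<Longrightarrow> dist (\<Phi> y) (\<Phi> x) < \<delta> / 2"
    by (rule uniformly_continuous_onE[OF uc2 half_gt_zero[OF \<delta>]]) (rule that)
  define e where "e = min 1 (min d1 d2)"
  have e: "e > 0" "e \<le> 1" "e \<le> d1" "e \<le> d2" using d1 d2 by (auto simp: e_def)
  define N where "N = (\<integral>y. bump e y \<partial>(lborel :: (real^'n) measure))"
  have N: "N > 0" unfolding N_def using integral_bump_pos[OF e(1), of "0::real^'n"] by simp
  have N_shift: "(\<integral>y. bump e (y - x) \<partial>lborel) = N" for x :: "real^'n"
  proof -
    have m: "bump e \<in> borel_measurable (borel :: (real^'n) measure)"
      using continuous_on_bump[OF continuous_on_id, of UNIV e] by (intro borel_measurable_continuous_onI) simp
    have "N = (\<integral>y. bump e y \<partial>distr lborel borel ((+) (- x)))" by (simp add: N_def lborel_distr_plus)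
    also have "\<dots> = (\<integral>y. bump e (- x + y) \<partial>lborel)" by (rule integral_distr[OF _ m]) simp
    finally show ?thesis by simp
  qed
  have kernel0: "bump e (y - x) = 0" if "norm x \<le> C" "norm y > C + 1" for x y :: "real^'n" and C
    using that e norm_triangle_sub[of y x] by (intro bump_eq_0) auto
  have kernel_int: "integrable lborel (\<lambda>y. bump e (y - x) * f y)" if f: "continuous_on UNIV f" for x :: "real^'n" and f
    by (rule integrable_continuous_compact_support[of _ "norm x + 1"])
       (use kernel0[of x "norm x"] in \<open>auto intro!: continuous_intros continuous_on_bump f\<close>)
  obtain a where a: "cball 0 (S + 2) \<subseteq> cbox (- a) (a::real^'n)"
    using bounded_subset_cbox_symmetric[OF bounded_cball] by blast
  define w where "w x = integral (cbox (- a) a) (\<lambda>y. bump e (y - x) * u y)" for x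
  have w_eq: "w x = (\<integral>y. bump e (y - x) * u y \<partial>lborel)" if x: "norm x \<le> S + 1" for x
  proof -
    have "((\<lambda>y. bump e (y - x) * u y) has_integral (\<integral>y. bump e (y - x) * u y \<partial>lborel)) UNIV"
      by (rule has_integral_integral_lborel[OF kernel_int[OF cu]])
    moreover have "(if y \<in> cbox (- a) a then bump e (y - x) * u y else 0) = bump e (y - x) * u y" for y
    proof (cases "y \<in> cbox (- a) a")
      case False
      then have "\<not> norm y \<le> S + 2" using a by (auto simp: subset_iff)
      then show ?thesis using kernel0[OF x, of y] by simp
    qed simp
    ultimately have "((\<lambda>y. if y \<in> cbox (- a) a then bump e (y - x) * u y else 0) has_integral
        (\<integral>y. bump e (y - x) * u y \<partial>lborel)) UNIV" by (simp only:)
    then show ?thesis unfolding w_def by (simp add: has_integral_restrict_UNIV integral_unique)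
  qed
  define Dw where "Dw x = integral (cbox (- a) a) (\<lambda>y. (4 * max 0 (e\<^sup>2 - (y - x) \<bullet> (y - x)) * u y) *\<^sub>R (y - x))" for x
  have w: "GDERIV w x :> Dw x" for x unfolding w_def Dw_def by (rule smoothing_has_gradient[OF cu])
  have cDw: "continuous_on UNIV Dw" unfolding Dw_def by (rule smoothing_has_gradient[OF cu])
  have average_le: "(\<integral>y. bump e (y - x) * f y \<partial>lborel) \<le> N * c"
    if f: "continuous_on UNIV f" and le: "\<And>y. norm (y - x) < e \<Longrightarrow> f y \<le> c" for x :: "real^'n" and f c
  proof -
    have "(\<integral>y. bump e (y - x) * f y \<partial>lborel) \<le> (\<integral>y. bump e (y - x) * c \<partial>lborel)"
    proof (intro integral_mono kernel_int f continuous_intros)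
      fix y show "bump e (y - x) * f y \<le> bump e (y - x) * c"
        using le[of y] bump_nonneg[of e "y - x"] bump_eq_0[of e "y - x"] e(1)
        by (cases "norm (y - x) < e") (auto intro: mult_left_mono)
    qed
    then show ?thesis by (simp add: N_shift)
  qed
  show thesis
  proof (rule that[of "\<lambda>x. w x / N" "\<lambda>x. (1 / N) *\<^sub>R Dw x"])
    show "GDERIV (\<lambda>x. w x / N) x :> (1 / N) *\<^sub>R Dw x" for x
      using has_derivative_mult_right[OF w[of x, unfolded gderiv_def], of "1 / N"] by (simp add: gderiv_def)
    show "continuous_on UNIV (\<lambda>x. (1 / N) *\<^sub>R Dw x)" by (intro continuous_intros cDw)
  next
    fix x :: "real^'n" assume x: "norm x \<le> S"
    have xw: "w x = (\<integral>y. bump e (y - x) * u y \<partial>lborel)" using x by (intro w_eq) simp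
    have near: "norm y \<le> S + 1" if "norm (y - x) < e" for y
      using that x e norm_triangle_sub[of y x] by linarith
    have u_near: "\<bar>u y - u x\<bar> \<le> \<delta>" if "norm (y - x) < e" for y
      using d1(2)[of x y] near[OF that] x that e by (simp add: dist_norm)
    have "w x \<le> N * (u x + \<delta>)" unfolding xw
      using u_near by (intro average_le cu) (auto simp: abs_le_iff algebra_simps)
    moreover have "(\<integral>y. bump e (y - x) * - u y \<partial>lborel) \<le> N * (- u x + \<delta>)"
      using u_near by (intro average_le continuous_intros cu) (auto simp: abs_le_iff algebra_simps)
    then have "N * (u x - \<delta>) \<le> w x" by (simp add: xw algebra_simps)
    ultimately show "\<bar>w x / N - u x\<bar> \<le> \<delta>" using N by (simp add: abs_le_iff field_simps)
    fix q :: "real^'n" assume q: "norm q \<le> R"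
    have c\<Phi>q: "continuous_on UNIV (\<lambda>y. \<Phi> (y, q))"
      by (intro continuous_on_compose2[OF c\<Phi>] continuous_intros) auto
    have \<Phi>_near: "\<Phi> (y, q) \<le> \<Phi> (x, q) + \<delta> / 2" if "norm (y - x) < e" for y
    proof -
      have "dist (\<Phi> (y, q)) (\<Phi> (x, q)) < \<delta> / 2"
        using near[OF that] x q that e by (intro d2(2)) (auto simp: dist_Pair_Pair dist_norm)
      then show ?thesis unfolding dist_real_def by linarith
    qed
    have ev: "\<forall>\<^sub>F n in sequentially.
        real n * (\<integral>y. bump e (y - x) * (u (y + (1 / real n) *\<^sub>R q) - u y) \<partial>lborel)
          \<le> (\<integral>y. bump e (y - x) * (\<Phi> (y, q) - l * u y) \<partial>lborel) + N * \<delta> / 2"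
    proof -
      have 1: "continuous_on UNIV (\<lambda>y. bump e (y - x))" by (intro continuous_on_bump continuous_intros)
      have 2: "N * \<delta> / 2 > 0" using N \<delta> by simp
      show ?thesis using weak[unfolded weak_subsolution_def] 1 2 bump_nonneg kernel0[OF x] by blast
    qed
    have shift: "\<forall>\<^sub>F n in sequentially. real n * (w (x + (1 / real n) *\<^sub>R q) - w x)
        = real n * (\<integral>y. bump e (y - x) * (u (y + (1 / real n) *\<^sub>R q) - u y) \<partial>lborel)"
    proof -
      have "(\<lambda>n. norm (x + (1 / real n) *\<^sub>R q)) \<longlonglongrightarrow> norm (x + 0 *\<^sub>R q)"
        by (intro tendsto_intros lim_1_over_n)
      then have "\<forall>\<^sub>F n in sequentially. norm (x + (1 / real n) *\<^sub>R q) < S + 1"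
        by (rule order_tendstoD(2)) (use x in simp)
      then show ?thesis
      proof eventually_elim
        case (elim n)
        define h where "h = (1 / real n) *\<^sub>R q"
        have cuh: "continuous_on UNIV (\<lambda>y. u (y + h))"
          by (intro continuous_on_compose2[OF cu] continuous_intros) auto
        have m: "(\<lambda>y. bump e (y - (x + h)) * u y) \<in> borel_measurable borel"
          by (intro borel_measurable_continuous_onI continuous_intros continuous_on_bump cu)
        have "w (x + h) = (\<integral>y. bump e (y - (x + h)) * u y \<partial>lborel)"
          using elim by (intro w_eq) (simp add: h_def)
        also have "\<dots> = (\<integral>y. bump e (y - (x + h)) * u y \<partial>distr lborel borel ((+) h))"
          by (simp add: lborel_distr_plus)
        also have "\<dots> = (\<integral>y. bump e (y - x) * u (y + h) \<partial>lborel)"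
          by (subst integral_distr[OF _ m]) (auto simp: add.commute)
        finally have "w (x + h) - w x = (\<integral>y. bump e (y - x) * u (y + h) - bump e (y - x) * u y \<partial>lborel)"
          using kernel_int[OF cu, of x] kernel_int[OF cuh, of x] by (simp add: xw)
        then show ?case by (simp add: h_def right_diff_distrib)
      qed
    qed
    have "Dw x \<bullet> q \<le> (\<integral>y. bump e (y - x) * (\<Phi> (y, q) - l * u y) \<partial>lborel) + N * \<delta> / 2"
    proof (rule tendsto_le[OF _ tendsto_const GDERIV_difference_quotient[OF w]])
      show "\<forall>\<^sub>F n in sequentially. real n * (w (x + (1 / real n) *\<^sub>R q) - w x)
          \<le> (\<integral>y. bump e (y - x) * (\<Phi> (y, q) - l * u y) \<partial>lborel) + N * \<delta> / 2"
        using ev shift by eventually_elim (simp only:)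
    qed simp
    also have "(\<integral>y. bump e (y - x) * (\<Phi> (y, q) - l * u y) \<partial>lborel)
        = (\<integral>y. bump e (y - x) * \<Phi> (y, q) - l * (bump e (y - x) * u y) \<partial>lborel)"
      by (simp add: algebra_simps)
    also have "\<dots> = (\<integral>y. bump e (y - x) * \<Phi> (y, q) \<partial>lborel) - l * w x"
      using kernel_int[OF cu, of x] kernel_int[OF c\<Phi>q, of x] by (simp add: xw)
    finally have "Dw x \<bullet> q + l * w x \<le> N * (\<Phi> (x, q) + \<delta> / 2) + N * \<delta> / 2"
      using average_le[OF c\<Phi>q \<Phi>_near, of x] by linarith
    then have "Dw x \<bullet> q + l * w x \<le> N * (\<Phi> (x, q) + \<delta>)" by (simp add: algebra_simps)
    then show "l * (w x / N) + ((1 / N) *\<^sub>R Dw x) \<bullet> q \<le> \<Phi> (x, q) + \<delta>"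
      using N by (simp add: field_simps)
  qed
qed

section \<open>The measure\<close>

lemma prob_space_imp_radon_measure:
  fixes \<mu> :: "'a::euclidean_space measure"
  assumes "prob_space \<mu>" "sets \<mu> = sets borel"
  shows "radon_measure \<mu>"
proof -
  interpret prob_space \<mu> by fact
  show ?thesis unfolding radon_measure_def
    using inner_regular[OF assms(2)] emeasure_finite assms(2) by (auto simp: less_top[symmetric])
qed

lemma pairing_eq_integral:
  assumes "integrable \<mu> \<Phi>"
  shows "pairing \<mu> \<Phi> = ereal (\<integral>w. \<Phi> w \<partial>\<mu>)"
proof -
  have 1: "(\<integral>\<^sup>+ w. ennreal (\<Phi> w) \<partial>\<mu>) < \<infinity>" "(\<integral>\<^sup>+ w. ennreal (- \<Phi> w) \<partial>\<mu>) < \<infinity>"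
    using assms by (auto elim!: integrableE simp: real_integrable_def less_top)
  have "enn2ereal a = ereal (enn2real a)" if "a < \<infinity>" for a
    using that by (cases a) (auto simp: enn2ereal_ennreal)
  with 1 show ?thesis
    unfolding pairing_def real_lebesgue_integral_def[OF assms] by simp
qed

text \<open>
  The model is the law of position and velocity along a curve on \<open>(-\<infinity>, 0]\<close> that ends at \<open>z\<close>, the time
  \<open>t\<close> having density \<open>l * exp (l * t)\<close>: there the identity is an integration by parts.  The constant
  \<open>l * v z\<close> is placed inside the integral so that the condition says that a linear space of functions
  is annihilated.
\<close>

definition discounted_closed ::
  "real \<Rightarrow> (real^'n) \<Rightarrow> ((real^'n) \<times> (real^'n)) measure \<Rightarrow> bool" where
  "discounted_closed l z \<mu> \<longleftrightarrow>
     (\<forall>v Dv. (\<forall>x. GDERIV v x :> Dv x) \<and> continuous_on UNIV Dv \<longrightarrow>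
        (\<integral>w. l * v (fst w) + Dv (fst w) \<bullet> snd w - l * v z \<partial>\<mu>) = 0)"

lemma continuous_on_GDERIV:
  assumes "\<And>x. GDERIV v x :> Dv x"
  shows "continuous_on S v"
  using assms unfolding gderiv_def
  by (meson continuous_at_imp_continuous_on has_derivative_continuous)

lemma integrable_continuous_AE_compact:
  fixes f :: "'a::euclidean_space \<Rightarrow> real"
  assumes \<mu>: "prob_space \<mu>" "sets \<mu> = sets borel" "AE w in \<mu>. w \<in> K" and K: "compact K"
    and f: "continuous_on UNIV f"
  shows "integrable \<mu> f"
proof -
  interpret prob_space \<mu> by fact
  have "bounded (f ` K)"
    using K by (intro compact_imp_bounded compact_continuous_image continuous_on_subset[OF f]) auto
  then obtain B where B: "\<And>w. w \<in> K \<Longrightarrow> norm (f w) \<le> B" unfolding bounded_iff by blast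
  show ?thesis
  proof (rule integrable_const_bound[of _ B])
    show "AE w in \<mu>. norm (f w) \<le> B" using \<mu>(3) by eventually_elim (rule B)
    show "f \<in> borel_measurable \<mu>"
      using borel_measurable_continuous_onI[OF f] measurable_cong_sets[OF \<mu>(2) refl] by blast
  qed
qed

text \<open>
  The equality for C1 functions is applied to a smoothing of \<open>u\<close>; all errors vanish with the smoothing
  parameter because \<open>\<mu>\<close> lives on a compact set.
\<close>

lemma weak_subsolution_le_integral:
  fixes \<mu> :: "((real^'n) \<times> (real^'n)) measure"
  assumes \<mu>: "prob_space \<mu>" "sets \<mu> = sets borel" "AE w in \<mu>. w \<in> K" and K: "compact K"
    and closed: "discounted_closed l z \<mu>" and l: "l > 0"
    and c\<Phi>: "continuous_on UNIV \<Phi>" and weak: "weak_subsolution l \<Phi> u"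
  shows "l * u z \<le> (\<integral>w. \<Phi> w \<partial>\<mu>)"
proof (rule field_le_epsilon)
  fix e :: real assume e: "e > 0"
  interpret prob_space \<mu> by fact
  note integrable = integrable_continuous_AE_compact[OF \<mu> K]
  obtain S0 where S0: "\<And>w. w \<in> K \<Longrightarrow> norm w \<le> S0"
    using compact_imp_bounded[OF K] unfolding bounded_iff by blast
  define S where "S = max S0 (norm z)"
  have S: "norm (fst w) \<le> S \<and> norm (snd w) \<le> S" if "w \<in> K" for w
    using S0[OF that] norm_fst_le[of "fst w" "snd w"] norm_snd_le[of "snd w" "fst w"] by (simp add: S_def le_max_iff_disj)
  define \<delta> where "\<delta> = e / (l + 1)"
  have "(l + 1) * \<delta> = e" "\<delta> > 0" using e l by (auto simp: \<delta>_def)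
  then have \<delta>: "\<delta> > 0" "l * \<delta> + \<delta> = e" by (simp_all add: distrib_right)
  obtain v Dv where v: "\<And>x. GDERIV v x :> Dv x" "continuous_on UNIV Dv"
    and sub: "\<And>x q. norm x \<le> S \<Longrightarrow> norm q \<le> S \<Longrightarrow> l * v x + Dv x \<bullet> q \<le> \<Phi> (x, q) + \<delta>"
    and near: "\<And>x. norm x \<le> S \<Longrightarrow> \<bar>v x - u x\<bar> \<le> \<delta>"
    by (rule weak_subsolution_smoothing[OF c\<Phi> weak \<delta>(1), of S S]) blast
  have "(\<integral>w. l * v (fst w) + Dv (fst w) \<bullet> snd w - l * v z \<partial>\<mu>) \<le> (\<integral>w. \<Phi> w + \<delta> - l * v z \<partial>\<mu>)"
  proof (rule integral_mono_AE)
    show "AE w in \<mu>. l * v (fst w) + Dv (fst w) \<bullet> snd w - l * v z \<le> \<Phi> w + \<delta> - l * v z"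
      using \<mu>(3)
    proof eventually_elim
      case (elim w)
      then show ?case using sub[of "fst w" "snd w"] S[OF elim] by simp
    qed
    show "integrable \<mu> (\<lambda>w. l * v (fst w) + Dv (fst w) \<bullet> snd w - l * v z)"
      by (intro integrable continuous_intros continuous_on_compose2[OF continuous_on_GDERIV[OF v(1)]]
          continuous_on_compose2[OF v(2)]) auto
    show "integrable \<mu> (\<lambda>w. \<Phi> w + \<delta> - l * v z)"
      by (intro integrable continuous_intros c\<Phi>)
  qed
  moreover have "(\<integral>w. l * v (fst w) + Dv (fst w) \<bullet> snd w - l * v z \<partial>\<mu>) = 0"
    using closed v unfolding discounted_closed_def by blast
  moreover have "(\<integral>w. \<Phi> w + \<delta> - l * v z \<partial>\<mu>) = (\<integral>w. \<Phi> w \<partial>\<mu>) + \<delta> - l * v z"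
    using integrable[OF c\<Phi>] prob_space by simp
  ultimately have "l * v z \<le> (\<integral>w. \<Phi> w \<partial>\<mu>) + \<delta>" by simp
  moreover have "l * u z \<le> l * (v z + \<delta>)"
    using near[of z] l by (intro mult_left_mono) (auto simp: S_def abs_le_iff)
  ultimately show "l * u z \<le> (\<integral>w. \<Phi> w \<partial>\<mu>) + e" using \<delta>(2) by (simp add: distrib_left)
qed

context superlinear_hamiltonian
begin

text \<open>
  The state constraint hidden in the ball makes the duality take place on a compact set.  The bound \<open>R\<close>
  on the velocities is fixed before \<open>v\<close> is known: it depends only on the level \<open>A\<close> at which \<open>v\<close> is
  truncated.
\<close>

lemma optimal_closed_measure:
  fixes z :: "real^'n"
  assumes l: "l > 0" and z: "z \<in> ball y r"
  obtains \<mu> K where "prob_space \<mu>" "sets \<mu> = sets borel" "compact K" "AE w in \<mu>. w \<in> K"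
    "discounted_closed l z \<mu>"
    "(\<integral>w. lagrangian H w \<partial>\<mu>) \<le> l * maximal_subsolution (ball y r) l H z"
proof -
  define X where "X = cball y r"
  have X: "compact X" by (simp add: X_def)
  obtain A where A: "\<And>x p. x \<in> X \<Longrightarrow> norm p \<le> 0 \<Longrightarrow> \<bar>H x p\<bar> \<le> A"
    using bounded_on_compact[OF X] by blast
  have A0: "H x 0 \<le> A" if "x \<in> X" for x using A[OF that, of 0] by simp
  obtain R where R: "R > 0"
    "\<And>x p a. x \<in> X \<Longrightarrow> a \<le> A \<Longrightarrow> (\<And>q. norm q \<le> R \<Longrightarrow> p \<bullet> q - lagrangian H (x, q) \<le> a) \<Longrightarrow> H x p \<le> a"
    using bounded_velocities_suffice[OF X A0] by metis
  obtain m where m: "\<And>x p. x \<in> X \<Longrightarrow> m \<le> H x p" using bounded_below[OF X] by blast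
  define w where "w = maximal_subsolution (ball y r) l H z"
  have below: "u z \<le> w" if u: "viscosity_subsolution (ball y r) (\<lambda>x r p. l * r + H x p) u" for u
    unfolding w_def maximal_subsolution_def
  proof (rule cSUP_upper)
    show "bdd_above ((\<lambda>u. u z) ` {u. viscosity_subsolution (ball y r) (\<lambda>x r p. l * r + H x p) u})"
      using viscosity_subsolution_upper_bound[OF open_ball z l, of H _ m] m
      by (intro bdd_aboveI2[of _ _ "- m / l"]) (auto simp: X_def)
  qed (use u in simp)
  define K where "K = X \<times> cball (0::real^'n) R"
  define h where "h p = lagrangian H p - l * w" for p
  define G where "G v Dv p = l * v (fst p) + Dv (fst p) \<bullet> snd p - l * v z"
    for v and Dv :: "real^'n \<Rightarrow> real^'n" and p
  define V where "V = {G v Dv | v Dv. (\<forall>x. GDERIV v x :> Dv x) \<and> continuous_on UNIV Dv}"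
  have K: "compact K" unfolding K_def by (intro compact_Times X compact_cball)
  have zX: "z \<in> X" using z by (simp add: X_def)
  have ch: "continuous_on UNIV h" unfolding h_def by (intro continuous_intros continuous_lagrangian)
  have cV: "continuous_on UNIV \<phi>" if "\<phi> \<in> V" for \<phi>
  proof -
    obtain v Dv where v: "\<And>x. GDERIV v x :> Dv x" "continuous_on UNIV Dv"
      and \<phi>: "\<phi> = G v Dv" using \<open>\<phi> \<in> V\<close> unfolding V_def by blast
    show ?thesis unfolding \<phi> G_def
      by (intro continuous_intros continuous_on_compose2[OF continuous_on_GDERIV[OF v(1)]]
          continuous_on_compose2[OF v(2)]) auto
  qed
  have alt: "\<exists>p\<in>K. h p \<le> \<phi> p" if \<phi>: "\<phi> \<in> V" for \<phi>
  proof (rule ccontr)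
    assume "\<not> ?thesis"
    then have pos: "\<And>p. p \<in> K \<Longrightarrow> 0 < h p - \<phi> p" by force
    obtain v Dv where v: "\<And>x. GDERIV v x :> Dv x"
      and \<phi>_eq: "\<phi> = G v Dv" using \<phi> unfolding V_def by blast
    have "K \<noteq> {}" using zX R(1) by (auto simp: K_def)
    moreover have "continuous_on K (\<lambda>p. h p - \<phi> p)"
      by (intro continuous_intros continuous_on_subset[OF ch] continuous_on_subset[OF cV[OF \<phi>]]) auto
    ultimately obtain p0 where p0: "p0 \<in> K" "\<And>p. p \<in> K \<Longrightarrow> h p0 - \<phi> p0 \<le> h p - \<phi> p"
      using continuous_attains_inf[OF K] by blast
    define \<delta> where "\<delta> = h p0 - \<phi> p0"
    have \<delta>: "\<delta> > 0" using pos[OF p0(1)] by (simp add: \<delta>_def)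
    \<comment> \<open>The inequality between \<open>h\<close> and \<open>\<phi>\<close> fixes \<open>v\<close> up to a constant only; the constant is chosen so that \<open>v' z\<close> exceeds \<open>w\<close> by what the margin \<open>\<delta>\<close> allows.\<close>
    define v' where "v' x = v x + (w - v z + \<delta> / l)" for x
    have v': "GDERIV v' x :> Dv x" for x
      using GDERIV_add[OF v GDERIV_const] by (simp add: v'_def[abs_def])
    have sub: "Dv x \<bullet> q - lagrangian H (x, q) \<le> - l * v' x" if "x \<in> X" "norm q \<le> R" for x q
    proof -
      have "\<delta> \<le> h (x, q) - \<phi> (x, q)" using p0(2)[of "(x, q)"] that by (simp add: K_def \<delta>_def)
      moreover have "l * v' x = l * v x + l * w - l * v z + \<delta>" using l by (simp add: v'_def algebra_simps)
      ultimately show ?thesis by (simp add: h_def \<phi>_eq G_def)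
    qed
    have "viscosity_subsolution (ball y r) (\<lambda>x r p. l * r + H x p) (\<lambda>x. max (v' x) (- A / l))"
    proof (rule viscosity_subsolution_max_const[OF v'])
      fix x assume x: "x \<in> ball y r" and le: "- A / l \<le> v' x"
      then have "x \<in> X" by (simp add: X_def)
      moreover have "- l * v' x \<le> A" using le l by (simp add: field_simps)
      ultimately have "H x (Dv x) \<le> - l * v' x" using sub by (intro R(2)) auto
      then show "l * v' x + H x (Dv x) \<le> 0" by simp
    next
      fix x assume "x \<in> ball y r"
      then show "l * (- A / l) + H x 0 \<le> 0" using A0[of x] l by (simp add: X_def)
    qed
    from below[OF this] have "v' z \<le> w" by simp
    then show False using divide_pos_pos[OF \<delta> l] by (simp add: v'_def)
  qed
  have zero: "(\<lambda>p. 0) \<in> V" unfolding V_def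
    by (intro CollectI exI[of _ "\<lambda>x. 0"]) (auto simp: GDERIV_const G_def fun_eq_iff)
  have lin: "(\<lambda>p. \<phi> p + c * \<psi> p) \<in> V" if "\<phi> \<in> V" "\<psi> \<in> V" for \<phi> \<psi> c
  proof -
    obtain v Dv where v: "\<And>x. GDERIV v x :> Dv x" "continuous_on UNIV Dv" "\<phi> = G v Dv"
      using \<open>\<phi> \<in> V\<close> unfolding V_def by blast
    obtain v' Dv' where v': "\<And>x. GDERIV v' x :> Dv' x" "continuous_on UNIV Dv'" "\<psi> = G v' Dv'"
      using \<open>\<psi> \<in> V\<close> unfolding V_def by blast
    have "GDERIV (\<lambda>x. v x + c * v' x) x :> Dv x + c *\<^sub>R Dv' x" for x
      using GDERIV_add[OF v(1) GDERIV_mult[OF GDERIV_const[of c] v'(1)]] by simp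
    moreover have "continuous_on UNIV (\<lambda>x. Dv x + c *\<^sub>R Dv' x)" by (intro continuous_intros v v')
    moreover have "(\<lambda>p. \<phi> p + c * \<psi> p) = G (\<lambda>x. v x + c * v' x) (\<lambda>x. Dv x + c *\<^sub>R Dv' x)"
      by (simp add: v(3) v'(3) G_def fun_eq_iff algebra_simps inner_add_left)
    ultimately show ?thesis unfolding V_def by blast
  qed
  have "\<exists>\<mu>. prob_space \<mu> \<and> sets \<mu> = sets borel \<and> (AE p in \<mu>. p \<in> K) \<and>
      (\<forall>\<phi>\<in>V. (\<integral>p. \<phi> p \<partial>\<mu>) = 0) \<and> (\<integral>p. h p \<partial>\<mu>) \<le> 0"
    by (rule measure_duality[OF K cV zero lin ch alt]; blast)
  then obtain \<mu> where \<mu>: "prob_space \<mu>" "sets \<mu> = sets borel" "AE p in \<mu>. p \<in> K"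
    "\<And>\<phi>. \<phi> \<in> V \<Longrightarrow> (\<integral>p. \<phi> p \<partial>\<mu>) = 0" "(\<integral>p. h p \<partial>\<mu>) \<le> 0" by blast
  interpret \<mu>: prob_space \<mu> by fact
  have "(\<integral>p. h p \<partial>\<mu>) = (\<integral>p. lagrangian H p \<partial>\<mu>) - l * w"
    using integrable_continuous_AE_compact[OF \<mu>(1-3) K continuous_lagrangian] \<mu>.prob_space
    by (simp add: h_def)
  then have "(\<integral>p. lagrangian H p \<partial>\<mu>) \<le> l * w" using \<mu>(5) by simp
  moreover have "discounted_closed l z \<mu>" unfolding discounted_closed_def
    using \<mu>(4) unfolding V_def G_def[abs_def] by blast
  ultimately show thesis using that \<mu>(1-3) K by (simp add: w_def)
qed

text \<open>
  The condition at infinity bounds \<open>H x 0\<close> from above for large \<open>x\<close>, continuity does so elsewhere, and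
  then a very negative constant is a subsolution.  The supremum defining the maximal subsolution is a
  supremum of reals, which can be estimated only once its index set is known to be nonempty.
\<close>

lemma exists_global_subsolution:
  assumes l: "l > 0"
    and A3: "\<exists>\<epsilon>>0. Limsup at_infinity (\<lambda>x. SUP p\<in>{p. norm p < \<epsilon>}. ereal (H x p)) < S"
  obtains u where "viscosity_subsolution UNIV (\<lambda>x r p. l * r + H x p) u"
proof -
  from A3 obtain \<epsilon> where \<epsilon>: "\<epsilon> > 0" "Limsup at_infinity (\<lambda>x. SUP p\<in>{p. norm p < \<epsilon>}. ereal (H x p)) < S" by blast
  obtain c where c: "Limsup at_infinity (\<lambda>x. SUP p\<in>{p. norm p < \<epsilon>}. ereal (H x p)) < ereal c"
    using ereal_dense2[OF \<epsilon>(2)] by blast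
  have "\<forall>\<^sub>F x in at_infinity. (SUP p\<in>{p. norm p < \<epsilon>}. ereal (H x p)) < ereal c"
    by (rule Limsup_lessD[OF c])
  then obtain b where b: "\<And>x. norm x \<ge> b \<Longrightarrow> (SUP p\<in>{p. norm p < \<epsilon>}. ereal (H x p)) < ereal c"
    unfolding eventually_at_infinity by blast
  have far: "H x 0 \<le> c" if "norm x \<ge> b" for x
  proof -
    have "ereal (H x 0) \<le> (SUP p\<in>{p. norm p < \<epsilon>}. ereal (H x p))" using \<epsilon>(1) by (intro SUP_upper) auto
    also have "\<dots> < ereal c" by (rule b[OF that])
    finally show ?thesis by simp
  qed
  obtain B where B: "\<And>x p. x \<in> cball 0 b \<Longrightarrow> norm p \<le> 0 \<Longrightarrow> \<bar>H x p\<bar> \<le> B"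
    using bounded_on_compact[OF compact_cball] by metis
  define A where "A = max c B"
  have A: "H x 0 \<le> A" for x
    using far[of x] B[of x 0] by (cases "norm x \<ge> b") (auto simp: A_def)
  define a where "a = - A / l"
  \<comment> \<open>A constant, written as the maximum of two equal functions to fit the truncation lemma.\<close>
  have "viscosity_subsolution UNIV (\<lambda>x r p. l * r + H x p) (\<lambda>x. max a a)"
    using A l by (intro viscosity_subsolution_max_const[OF GDERIV_const]) (auto simp: a_def)
  then show thesis by (rule that)
qed

end

theorem theorem7p1:
  fixes H :: "real^'n \<Rightarrow> real^'n \<Rightarrow> real"
    and z :: "real^'n"
    and lz :: real
  assumes A1: "continuous_on UNIV (\<lambda>(x, p). H x p)"
    and A2_convex: "\<And>x. convex_on UNIV (H x)"
    and A2_coercive: "\<And>R. R > 0 \<Longrightarrow>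
      ((\<lambda>r::real. INF (x, p)\<in>{(x, p). norm x < R \<and> norm p \<ge> r}. ereal (H x p))
         \<longlongrightarrow> \<infinity>) at_top"
    and A3: "\<exists>\<epsilon>>0. Limsup at_infinity (\<lambda>x. SUP p\<in>{p. norm p < \<epsilon>}. ereal (H x p))
                    < (SUP x. INF p. ereal (H x p))"
    and superlinear: "\<And>x. filterlim (\<lambda>p. H x p / norm p) at_top at_infinity"
    and critical: "critical_value H = 0"
    and lz_pos: "lz > 0"
    and lz: "\<And>l. 0 < l \<Longrightarrow> l < lz \<Longrightarrow>
      \<exists>y r. z \<in> ball y r \<and>
        maximal_subsolution UNIV l H z = maximal_subsolution (ball y r) l H z"
  shows "\<forall>l. 0 < l \<and> l < lz \<longrightarrow>
    (\<exists>\<mu> :: ((real^'n) \<times> (real^'n)) measure.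
       radon_measure \<mu> \<and> prob_space \<mu> \<and>
       pairing \<mu> (lagrangian H) = ereal (l * maximal_subsolution UNIV l H z) \<and>
       (\<forall>\<Phi> u. continuous_on UNIV \<Phi> \<and> bdd_below (range \<Phi>) \<and> discounted_subsolution l \<Phi> u \<longrightarrow>
          pairing \<mu> \<Phi> \<ge> ereal (l * u z)))"
proof (intro allI impI)
  fix l assume l: "0 < l \<and> l < lz"
  have ham: "superlinear_hamiltonian H"
    by unfold_locales (rule A1 A2_convex superlinear)+
  interpret superlinear_hamiltonian H by (rule ham)
  obtain y r where z: "z \<in> ball y r"
    and coincide: "maximal_subsolution UNIV l H z = maximal_subsolution (ball y r) l H z"
    using lz l by blast
  obtain \<mu> K where \<mu>: "prob_space \<mu>" "sets \<mu> = sets borel" "compact K" "AE w in \<mu>. w \<in> K"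
    "discounted_closed l z \<mu>" "(\<integral>w. lagrangian H w \<partial>\<mu>) \<le> l * maximal_subsolution (ball y r) l H z"
    using optimal_closed_measure[OF _ z] l by blast
  note pairing = pairing_eq_integral[OF integrable_continuous_AE_compact[OF \<mu>(1,2,4,3)]]
  have "maximal_subsolution UNIV l H z \<le> (\<integral>w. lagrangian H w \<partial>\<mu>) / l"
    unfolding maximal_subsolution_def
  proof (rule cSUP_least)
    show "{u. viscosity_subsolution UNIV (\<lambda>x r p. l * r + H x p) u} \<noteq> {}"
      using exists_global_subsolution[OF _ A3] l by blast
    fix u assume "u \<in> {u. viscosity_subsolution UNIV (\<lambda>x r p. l * r + H x p) u}"
    then have "weak_subsolution l (lagrangian H) u"
      using viscosity_imp_weak_subsolution[OF ham] by simp
    then have "l * u z \<le> (\<integral>w. lagrangian H w \<partial>\<mu>)"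
      using weak_subsolution_le_integral[OF \<mu>(1,2,4,3,5) _ continuous_lagrangian] l by blast
    then show "u z \<le> (\<integral>w. lagrangian H w \<partial>\<mu>) / l" using l by (simp add: field_simps)
  qed
  then have "l * maximal_subsolution UNIV l H z \<le> (\<integral>w. lagrangian H w \<partial>\<mu>)"
    using l by (simp add: field_simps)
  with \<mu>(6) coincide have "(\<integral>w. lagrangian H w \<partial>\<mu>) = l * maximal_subsolution UNIV l H z" by simp
  then have L: "pairing \<mu> (lagrangian H) = ereal (l * maximal_subsolution UNIV l H z)"
    using pairing[OF continuous_lagrangian] by simp
  have ge: "ereal (l * u z) \<le> pairing \<mu> \<Phi>"
    if "continuous_on UNIV \<Phi>" "discounted_subsolution l \<Phi> u" for \<Phi> u
    using weak_subsolution_le_integral[OF \<mu>(1,2,4,3,5) _ that(1) discounted_imp_weak_subsolution[OF that]] l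
      pairing[OF that(1)] by simp
  show "\<exists>\<mu> :: ((real^'n) \<times> (real^'n)) measure.
       radon_measure \<mu> \<and> prob_space \<mu> \<and>
       pairing \<mu> (lagrangian H) = ereal (l * maximal_subsolution UNIV l H z) \<and>
       (\<forall>\<Phi> u. continuous_on UNIV \<Phi> \<and> bdd_below (range \<Phi>) \<and> discounted_subsolution l \<Phi> u \<longrightarrow>
          pairing \<mu> \<Phi> \<ge> ereal (l * u z))"
    using prob_space_imp_radon_measure[OF \<mu>(1,2)] \<mu>(1) L ge by blast
qed

end
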